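(* Let $n\geq 2$ and $a>0$, and equip $\mathcal{O}_{\mathbb{CP}^{n-1}}(-n)$ with the Ricci-flat Calabi-Eguchi-Hanson metric with parameter $a$. Then any compact minimal submanifold (without boundary, of positive dimension) of $\mathcal{O}_{\mathbb{CP}^{n-1}}(-n)$ is contained in the zero section $\mathbb{CP}^{n-1}\subset\mathcal{O}_{\mathbb{CP}^{n-1}}(-n)$.
   Context: $\mu_n$ is the group of $n$-th roots of unity acting on $\mathbb{C}^n$ by scalar multiplication. The total space of $\mathcal{O}(-n)$ is $\mathcal{O}_{\mathbb{CP}^{n-1}}(-n)=\{(z,[\xi]) : z^i(\xi^j)^n=z^j(\xi^i)^n\ \forall i,j\}\subset\mathbb{C}^n\times\mathbb{CP}^{n-1}$, with zero section $\{(0,[\xi])\}\cong\mathbb{CP}^{n-1}$. The blow-down map $\pi:\mathcal{O}_{\mathbb{CP}^{n-1}}(-n)\to\mathbb{C}^n/\mu_n$ is given over $\{\xi^i\neq0\}$, with $\zeta^j=\xi^j/\xi^i$ and $t=z^i$ (so $z^j=(\zeta^j)^n t$), by $(z,[\xi])\mapsto[t^{1/n}(\zeta^1,\dots,\zeta^n)]$, where $\zeta^i=1$ and $t^{1/n}$ is any $n$-th root of $t$. It restricts to a biholomorphism $\mathcal{O}_{\mathbb{CP}^{n-1}}(-n)\setminus\mathbb{CP}^{n-1}\cong(\mathbb{C}^n\setminus\{0\})/\mu_n$. For a parameter $a>0$, the Calabi-Eguchi-Hanson metric is the Ricci-flat Kähler metric on $\mathcal{O}_{\mathbb{CP}^{n-1}}(-n)$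 which, under this identification, is given on $(\mathbb{C}^n\setminus\{0\})/\mu_n$ in standard coordinates by $$g_{\mu\bar\nu}=\sqrt[n]{1+\frac{a^n}{u^n}}\left(\delta_{\mu\bar\nu}-\frac{a^n}{a^n+u^n}\frac{\bar z_\mu z_\nu}{u}\right),\qquad u=|z|^2_{\mathbb{C}^n},$$ where indices on $z$ are lowered with the Euclidean metric ($z_\nu=z^\nu$, $\bar z_\mu=\bar z^\mu$); it extends smoothly across the zero section. Submanifolds are real submanifolds; minimal means vanishing mean curvature. *)

theory Defs
  imports "HOL-Analysis.Analysis"
begin

section \<open>Complex projective space\<close>

text \<open>
  The dimension \<open>n\<close> is \<open>CARD('n)\<close>, and the type \<open>'n cproj\<close> is the projective space of
  \<open>complex ^ 'n\<close>. Every element of it is \<open>hom \<xi>\<close> for some nonzero \<open>\<xi>\<close>; the value \<open>hom 0\<close> is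
  unspecified.
\<close>

quotient_type (overloaded) 'n cproj =
  "complex ^ ('n::finite)" / partial: "\<lambda>x y. x \<noteq> 0 \<and> y \<noteq> 0 \<and> (\<exists>c. y = c *s x)"
proof (rule part_equivpI)
  let ?R = "\<lambda>x y. x \<noteq> (0::complex^'n) \<and> y \<noteq> 0 \<and> (\<exists>c. y = c *s x)"
  have "?R 1 1" by (auto intro: exI[of _ 1])
  then show "\<exists>x. ?R x x" by blast
  show "symp ?R"
  proof (rule sympI)
    fix x y assume R: "?R x y"
    then obtain c where c: "y = c *s x" by blast
    with R have "c \<noteq> 0" by auto
    then have "x = inverse c *s y" using c by (simp add: vector_smult_assoc)
    with R show "?R y x" by blast
  qed
  show "transp ?R"
  proof (rule transpI)
    fix x y z assume "?R x y" "?R y z"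
    then obtain c d where "y = c *s x" "z = d *s y" by blast
    then have "z = (d * c) *s x" by (simp add: vector_smult_assoc)
    with \<open>?R x y\<close> \<open>?R y z\<close> show "?R x z" by blast
  qed
qed

abbreviation hom :: "complex ^ 'n::finite \<Rightarrow> 'n cproj" where
  "hom \<equiv> abs_cproj"

lemma hom_eq_iff:
  assumes "x \<noteq> 0" "y \<noteq> 0"
  shows "hom x = hom y \<longleftrightarrow> (\<exists>c. y = c *s x)"
proof -
  have refl: "(x \<noteq> 0 \<and> x \<noteq> 0 \<and> (\<exists>c. x = c *s x)) = True"
    "(y \<noteq> 0 \<and> y \<noteq> 0 \<and> (\<exists>c. y = c *s y)) = True"
    using assms vector_smult_lid[of x] vector_smult_lid[of y] by metis+
  show ?thesis
    using Quotient_rel[OF Quotient_cproj, of x y] assms unfolding refl by simp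
qed

lemma cproj_cases:
  obtains \<xi> where "\<xi> \<noteq> 0" "L = hom \<xi>"
proof
  show "rep_cproj L \<noteq> 0"
    using Quotient_rep_reflp[OF Quotient_cproj, of L] by simp
  show "L = hom (rep_cproj L)"
    by (rule Quotient_abs_rep[OF Quotient_cproj, symmetric])
qed

text \<open>The topology is the quotient topology of \<open>\<complex>\<^sup>n - {0}\<close>.\<close>

instantiation cproj :: (finite) topological_space
begin

definition open_cproj :: "'a cproj set \<Rightarrow> bool" where
  "open_cproj U \<longleftrightarrow> open {\<xi>. \<xi> \<noteq> 0 \<and> hom \<xi> \<in> U}"

instance
proof
  have "{\<xi>::complex^'a. \<xi> \<noteq> 0} = - {0}" by auto
  moreover have "open (- {0::complex^'a})" by (rule open_Compl) simp
  ultimately show "open (UNIV :: 'a cproj set)" by (simp add: open_cproj_def)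
next
  fix S T :: "'a cproj set" assume "open S" "open T"
  moreover have "{\<xi>. \<xi> \<noteq> 0 \<and> hom \<xi> \<in> S \<inter> T} =
      {\<xi>. \<xi> \<noteq> 0 \<and> hom \<xi> \<in> S} \<inter> {\<xi>. \<xi> \<noteq> 0 \<and> hom \<xi> \<in> T}" by auto
  ultimately show "open (S \<inter> T)" by (simp add: open_cproj_def open_Int)
next
  fix K :: "'a cproj set set" assume "\<forall>S\<in>K. open S"
  moreover have "{\<xi>. \<xi> \<noteq> 0 \<and> hom \<xi> \<in> \<Union>K} = (\<Union>S\<in>K. {\<xi>. \<xi> \<noteq> 0 \<and> hom \<xi> \<in> S})" by auto
  ultimately show "open (\<Union>K)" by (auto simp: open_cproj_def intro!: open_UN)
qed

end


section \<open>The total space of \<open>\<O>(-n)\<close>, its charts, and the blow-down map\<close>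

definition total_space :: "((complex ^ 'n::finite) \<times> 'n cproj) set" where
  "total_space = {(z, hom \<xi>) | z \<xi>. \<xi> \<noteq> 0 \<and>
     (\<forall>i j. z $ i * (\<xi> $ j) ^ CARD('n) = z $ j * (\<xi> $ i) ^ CARD('n))}"

definition zero_section :: "((complex ^ 'n::finite) \<times> 'n cproj) set" where
  "zero_section = {(0, hom \<xi>) | \<xi>. \<xi> \<noteq> 0}"

definition chart_dom :: "'n::finite \<Rightarrow> ((complex ^ 'n) \<times> 'n cproj) set" where
  "chart_dom i = {(z, hom \<xi>) | z \<xi>. (z, hom \<xi>) \<in> total_space \<and> \<xi> \<noteq> 0 \<and> \<xi> $ i \<noteq> 0}"

text \<open>
  The chart over \<open>{\<xi>\<^sup>i \<noteq> 0}\<close> has the \<open>n\<close> complex coordinates \<open>t = z\<^sup>i\<close> and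
  \<open>\<zeta>\<^sup>j = \<xi>\<^sup>j / \<xi>\<^sup>i\<close> for \<open>j \<noteq> i\<close>. They are collected in one vector of \<open>complex ^ 'n\<close>, whose
  \<open>i\<close>-th entry, where \<open>\<zeta>\<^sup>i = 1\<close> carries no information, holds \<open>t\<close>.
\<close>

definition chart :: "'n::finite \<Rightarrow> (complex ^ 'n) \<times> 'n cproj \<Rightarrow> complex ^ 'n" where
  "chart i p = (\<chi> j. if j = i then fst p $ i
                     else rep_cproj (snd p) $ j / rep_cproj (snd p) $ i)"

definition affine_part :: "'n::finite \<Rightarrow> complex ^ 'n \<Rightarrow> complex ^ 'n" where
  "affine_part i y = (\<chi> j. if j = i then 1 else y $ j)"

definition chart_inv :: "'n::finite \<Rightarrow> complex ^ 'n \<Rightarrow> (complex ^ 'n) \<times> 'n cproj" where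
  "chart_inv i y = ((\<chi> j. (affine_part i y $ j) ^ CARD('n) * y $ i), hom (affine_part i y))"

text \<open>A point of \<open>\<complex>\<^sup>n / \<mu>\<^sub>n\<close> is represented by the corresponding \<open>\<mu>\<^sub>n\<close>-orbit in \<open>\<complex>\<^sup>n\<close>.\<close>

definition mu_orbit :: "complex ^ 'n::finite \<Rightarrow> (complex ^ 'n) set" where
  "mu_orbit w = {\<omega> *s w | \<omega>. \<omega> ^ CARD('n) = 1}"

definition blowdown :: "(complex ^ 'n::finite) \<times> 'n cproj \<Rightarrow> (complex ^ 'n) set" where
  "blowdown p = {b *s (\<chi> j. \<xi> $ j / \<xi> $ i) | b \<xi> i.
     \<xi> \<noteq> 0 \<and> snd p = hom \<xi> \<and> \<xi> $ i \<noteq> 0 \<and> b ^ CARD('n) = fst p $ i}"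

lemma affine_part_nth [simp]: "affine_part i y $ i = 1"
  by (simp add: affine_part_def)

lemma affine_part_nonzero [simp]: "affine_part i y \<noteq> 0"
  by (metis affine_part_nth zero_index zero_neq_one)

lemma chart_inv_in_chart_dom: "chart_inv i y \<in> chart_dom i"
proof -
  have "chart_inv i y \<in> total_space"
    unfolding chart_inv_def total_space_def
    by (auto intro!: exI[of _ "affine_part i y"])
  then show ?thesis
    unfolding chart_dom_def chart_inv_def
    by (auto intro!: exI[of _ "affine_part i y"])
qed

lemma chart_hom:
  assumes "\<xi> \<noteq> 0" "\<xi> $ i \<noteq> 0"
  shows "chart i (z, hom \<xi>) = (\<chi> j. if j = i then z $ i else \<xi> $ j / \<xi> $ i)"
proof -
  obtain \<eta> where \<eta>: "\<eta> = rep_cproj (hom \<xi>)" by simp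
  have "\<eta> \<noteq> 0"
    unfolding \<eta> using Quotient_rep_reflp[OF Quotient_cproj, of "hom \<xi>"] by simp
  moreover have "hom \<eta> = hom \<xi>"
    unfolding \<eta> by (rule Quotient_abs_rep[OF Quotient_cproj])
  ultimately obtain c where c: "\<xi> = c *s \<eta>"
    using hom_eq_iff[of \<eta> \<xi>] assms by blast
  with assms have "c \<noteq> 0" by auto
  then show ?thesis
    unfolding chart_def fst_conv snd_conv \<eta>[symmetric] by (simp add: vec_eq_iff c)
qed

lemma chart_chart_inv: "chart i (chart_inv i y) = y"
  unfolding chart_inv_def
  by (subst chart_hom) (auto simp: vec_eq_iff affine_part_def)

lemma chart_inv_chart:
  assumes "p \<in> chart_dom i"
  shows "chart_inv i (chart i p) = p"
proof -
  from assms obtain z \<xi> where p: "p = (z, hom \<xi>)" and t: "p \<in> total_space"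
    and \<xi>: "\<xi> \<noteq> 0" "\<xi> $ i \<noteq> 0"
    unfolding chart_dom_def by blast
  from t obtain \<eta> where \<eta>: "hom \<xi> = hom \<eta>" "\<eta> \<noteq> 0"
    "\<And>i j. z $ i * (\<eta> $ j) ^ CARD('a) = z $ j * (\<eta> $ i) ^ CARD('a)"
    unfolding total_space_def p by blast
  then obtain c where c: "\<xi> = c *s \<eta>" using hom_eq_iff[of \<eta> \<xi>] \<xi> by metis
  with \<xi> have c0: "c \<noteq> 0" and e0: "\<eta> $ i \<noteq> 0" by auto
  have aff: "affine_part i (chart i p) = inverse (\<xi> $ i) *s \<xi>"
    unfolding p chart_hom[OF \<xi>] using \<xi> by (auto simp: vec_eq_iff affine_part_def divide_simps)
  have "hom (inverse (\<xi> $ i) *s \<xi>) = hom \<xi>"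
  proof (subst hom_eq_iff)
    show "inverse (\<xi> $ i) *s \<xi> \<noteq> 0" using aff affine_part_nonzero by metis
    show "\<exists>d. \<xi> = d *s (inverse (\<xi> $ i) *s \<xi>)"
      using \<xi> by (intro exI[of _ "\<xi> $ i"]) (simp add: vector_smult_assoc)
  qed (rule \<xi>)
  moreover have "((inverse (\<xi> $ i) *s \<xi>) $ j) ^ CARD('a) * chart i p $ i = z $ j" for j
    unfolding p chart_hom[OF \<xi>] using c c0 e0 \<eta>(3)[of i j]
    by (simp add: power_mult_distrib field_simps)
  ultimately show ?thesis
    unfolding chart_inv_def aff by (simp add: p vec_eq_iff)
qed

lemma blowdown_chart_inv:
  fixes y :: "complex ^ 'n::finite"
  shows "blowdown (chart_inv i y) = {b *s affine_part i y | b. b ^ CARD('n) = y $ i}"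
proof (intro equalityI subsetI)
  fix w assume "w \<in> blowdown (chart_inv i y)"
  then obtain b \<xi> k where w: "w = b *s (\<chi> j. \<xi> $ j / \<xi> $ k)" and \<xi>: "\<xi> \<noteq> 0" "\<xi> $ k \<noteq> 0"
    and h: "hom (affine_part i y) = hom \<xi>"
    and b: "b ^ CARD('n) = (affine_part i y $ k) ^ CARD('n) * y $ i"
    unfolding blowdown_def chart_inv_def by auto
  from h obtain c where c: "\<xi> = c *s affine_part i y"
    using hom_eq_iff[of "affine_part i y" \<xi>] \<xi> by auto
  with \<xi> have c0: "c \<noteq> 0" "affine_part i y $ k \<noteq> 0" by auto
  have "w = (b / affine_part i y $ k) *s affine_part i y"
    using c0 by (simp add: w c vec_eq_iff)
  moreover have "(b / affine_part i y $ k) ^ CARD('n) = y $ i"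
    using c0 by (simp add: power_divide b)
  ultimately show "w \<in> {b *s affine_part i y | b. b ^ CARD('n) = y $ i}" by blast
next
  fix w assume "w \<in> {b *s affine_part i y | b. b ^ CARD('n) = y $ i}"
  then obtain b where "w = b *s affine_part i y" "b ^ CARD('n) = y $ i" by blast
  then show "w \<in> blowdown (chart_inv i y)"
    unfolding blowdown_def chart_inv_def
    by (auto simp: vec_eq_iff intro!: exI[of _ b] exI[of _ "affine_part i y"] exI[of _ i])
qed

lemma blowdown_eq_mu_orbit:
  fixes y :: "complex ^ 'n::finite"
  assumes "w \<in> blowdown (chart_inv i y)"
  shows "blowdown (chart_inv i y) = mu_orbit w"
proof -
  from assms obtain b where w: "w = b *s affine_part i y" and b: "b ^ CARD('n) = y $ i"
    unfolding blowdown_chart_inv by blast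
  have "(\<exists>b'. x = b' *s affine_part i y \<and> b' ^ CARD('n) = y $ i) \<longleftrightarrow>
      (\<exists>\<omega>. x = \<omega> *s w \<and> \<omega> ^ CARD('n) = 1)" for x
  proof
    assume "\<exists>b'. x = b' *s affine_part i y \<and> b' ^ CARD('n) = y $ i"
    then obtain b' where b': "x = b' *s affine_part i y" "b' ^ CARD('n) = y $ i" by blast
    show "\<exists>\<omega>. x = \<omega> *s w \<and> \<omega> ^ CARD('n) = 1"
    proof (cases "b = 0")
      case True
      then show ?thesis using b b' w 
        by (intro exI[of _ 1]) (auto simp: zero_power)
    next
      case False
      then show ?thesis using b b' w
        by (intro exI[of _ "b' / b"]) (auto simp: vec_eq_iff power_divide)
    qed
  next
    assume "\<exists>\<omega>. x = \<omega> *s w \<and> \<omega> ^ CARD('n) = 1"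
    then obtain \<omega> where "x = \<omega> *s w" "\<omega> ^ CARD('n) = 1" by blast
    then show "\<exists>b'. x = b' *s affine_part i y \<and> b' ^ CARD('n) = y $ i"
      using b w by (intro exI[of _ "\<omega> * b"]) (simp add: vector_smult_assoc power_mult_distrib)
  qed
  then show ?thesis unfolding blowdown_chart_inv mu_orbit_def by blast
qed


section \<open>The Calabi-Eguchi-Hanson metric\<close>

text \<open>
  The Riemannian metric on \<open>\<complex>\<^sup>n - {0}\<close> at the point \<open>w\<close>: the real part of
  \<open>\<Sum>\<mu> \<nu>. g\<^sub>\<mu>\<^sub>\<nu> V\<^sup>\<mu> cnj (V'\<^sup>\<nu>)\<close>.
\<close>

definition ceh_coeff :: "real \<Rightarrow> complex ^ 'n::finite \<Rightarrow> 'n \<Rightarrow> 'n \<Rightarrow> complex" where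
  "ceh_coeff a w \<mu> \<nu> = (let n = CARD('n); u = (norm w)\<^sup>2 in
     of_real (root n (1 + a ^ n / u ^ n)) *
       ((if \<mu> = \<nu> then 1 else 0) -
        of_real (a ^ n / (a ^ n + u ^ n)) * (cnj (w $ \<mu>) * w $ \<nu> / of_real u)))"

definition ceh_flat :: "real \<Rightarrow> complex ^ 'n::finite \<Rightarrow> complex ^ 'n \<Rightarrow> complex ^ 'n \<Rightarrow> real" where
  "ceh_flat a w V V' = Re (\<Sum>\<mu>\<in>UNIV. \<Sum>\<nu>\<in>UNIV. ceh_coeff a w \<mu> \<nu> * V $ \<mu> * cnj (V' $ \<nu>))"

text \<open>
  Off the zero section the metric, in the \<open>i\<close>-th chart, is the pullback along the blow-down map.
  As the latter takes values in \<open>\<complex>\<^sup>n / \<mu>\<^sub>n\<close>, it is differentiated through a local lift \<open>s\<close> to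
  \<open>\<complex>\<^sup>n\<close>; two lifts differ locally by a root of unity, which preserves \<open>ceh_flat\<close>.
\<close>

definition ceh_pullback ::
    "real \<Rightarrow> 'n::finite \<Rightarrow> complex ^ 'n \<Rightarrow> complex ^ 'n \<Rightarrow> complex ^ 'n \<Rightarrow> real" where
  "ceh_pullback a i y v v' = (THE c. \<exists>s D.
     (\<forall>\<^sub>F y' in nhds y. s y' \<in> blowdown (chart_inv i y')) \<and>
     (s has_derivative D) (at y) \<and> c = ceh_flat a (s y) (D v) (D v'))"

text \<open>
  On the zero section, which is \<open>y $ i = 0\<close> in the \<open>i\<close>-th chart, the metric is the continuous
  extension. That the limit exists, and that the result is smooth, is visible from
  \<open>ceh_metric_closed_form\<close> below.
\<close>

definition ceh_metric ::
    "real \<Rightarrow> 'n::finite \<Rightarrow> complex ^ 'n \<Rightarrow> complex ^ 'n \<Rightarrow> complex ^ 'n \<Rightarrow> real" where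
  "ceh_metric a i y v v' =
     (if y $ i \<noteq> 0 then ceh_pullback a i y v v'
      else Lim (at y within {y'. y' $ i \<noteq> 0}) (\<lambda>y'. ceh_pullback a i y' v v'))"

text \<open>
  With \<open>w = t\<^bsup>1/n\<^esup> \<zeta>\<close> one has \<open>dw = t\<^bsup>1/n\<^esup> (d\<zeta> + \<zeta> dt / (n t))\<close>; substituting this in the formula for the
  metric gives an expression without negative powers of \<open>t\<close>.
\<close>

definition herm :: "complex ^ 'n::finite \<Rightarrow> complex ^ 'n \<Rightarrow> complex" where
  "herm x y = (\<Sum>j\<in>UNIV. x $ j * cnj (y $ j))"

lemma herm_add_left: "herm (x + x') y = herm x y + herm x' y"
  by (simp add: herm_def algebra_simps sum.distrib)
lemma herm_add_right: "herm x (y + y') = herm x y + herm x y'"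
  by (simp add: herm_def algebra_simps sum.distrib)
lemma herm_scale_left: "herm (c *s x) y = c * herm x y"
  by (simp add: herm_def algebra_simps sum_distrib_left)
lemma herm_scale_right: "herm x (c *s y) = cnj c * herm x y"
  by (simp add: herm_def algebra_simps sum_distrib_left)
lemma herm_cnj: "cnj (herm x y) = herm y x"
  by (simp add: herm_def algebra_simps)
lemma herm_self: "herm x x = of_real ((norm x)\<^sup>2)"
proof -
  have "(norm x)\<^sup>2 = (\<Sum>j\<in>UNIV. (norm (x $ j))\<^sup>2)"
    by (simp add: norm_vec_def L2_set_def sum_nonneg)
  then show ?thesis
    by (simp only: herm_def of_real_sum complex_norm_square)
qed

lemma ceh_flat_herm:
  fixes w :: "complex ^ 'n::finite"
  shows "ceh_flat a w V V' = (let n = CARD('n); u = (norm w)\<^sup>2 in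
    root n (1 + a ^ n / u ^ n) *
    Re (herm V V' - of_real (a ^ n / (a ^ n + u ^ n) / u) * (herm V w * herm w V')))"
proof -
  define n where "n = CARD('n)"
  define u where "u = (norm w)\<^sup>2"
  define R where "R = root n (1 + a ^ n / u ^ n)"
  define q where "q = a ^ n / (a ^ n + u ^ n)"
  have "(\<Sum>\<mu>\<in>UNIV. \<Sum>\<nu>\<in>UNIV. ceh_coeff a w \<mu> \<nu> * V $ \<mu> * cnj (V' $ \<nu>)) =
     (\<Sum>\<mu>\<in>UNIV. \<Sum>\<nu>\<in>UNIV. of_real R * ((if \<mu> = \<nu> then V $ \<mu> * cnj (V' $ \<nu>) else 0)
        - of_real (q / u) * ((V $ \<mu> * cnj (w $ \<mu>)) * (w $ \<nu> * cnj (V' $ \<nu>)))))"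
    unfolding ceh_coeff_def Let_def n_def[symmetric] u_def[symmetric] R_def[symmetric] q_def[symmetric]
    by (intro sum.cong refl) (simp add: algebra_simps)
  also have "\<dots> = of_real R * (herm V V' - of_real (q / u) * (herm V w * herm w V'))"
    by (simp only: sum_distrib_left[symmetric] sum_subtractf herm_def sum_product) simp
  finally show ?thesis
    unfolding ceh_flat_def Let_def n_def[symmetric] u_def[symmetric] R_def[symmetric] q_def[symmetric]
    by simp
qed

definition fibre_part :: "'n::finite \<Rightarrow> complex ^ 'n \<Rightarrow> complex ^ 'n" where
  "fibre_part i v = (\<chi> j. if j = i then 0 else v $ j)"

definition ceh_closed ::
    "real \<Rightarrow> 'n::finite \<Rightarrow> complex ^ 'n \<Rightarrow> complex ^ 'n \<Rightarrow> complex ^ 'n \<Rightarrow> real" where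
  "ceh_closed a i y v v' =
    (let n = CARD('n); \<zeta> = affine_part i y; r = (norm \<zeta>)\<^sup>2; t = y $ i;
         H = a ^ n + (norm t)\<^sup>2 * r ^ n;
         \<eta> = fibre_part i v; \<eta>' = fibre_part i v';
         \<theta> = t * herm \<eta> \<zeta> + of_real (r / n) * v $ i;
         \<theta>' = t * herm \<eta>' \<zeta> + of_real (r / n) * v' $ i
     in root n H * Re (herm \<eta> \<eta>' / of_real r - herm \<eta> \<zeta> * cnj (herm \<eta>' \<zeta>) / of_real (r\<^sup>2)
          + of_real (r ^ n / (r\<^sup>2 * H)) * (\<theta> * cnj \<theta>')))"

lemma affine_part_deriv: "(affine_part i has_derivative fibre_part i) (at y)"
proof -
  have "linear (fibre_part i)"
    by (rule linearI) (auto simp: fibre_part_def vec_eq_iff)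
  then have "bounded_linear (fibre_part i)"
    by (simp add: linear_conv_bounded_linear)
  moreover have "affine_part i = (\<lambda>y. axis i 1 + fibre_part i y)"
    by (auto simp: fun_eq_iff affine_part_def fibre_part_def axis_def vec_eq_iff)
  ultimately show ?thesis
    by (auto intro!: derivative_eq_intros bounded_linear_imp_has_derivative)
qed

lemma bounded_bilinear_vector_smult:
  "bounded_bilinear (\<lambda>(c::complex) (x::complex^'n::finite). c *s x)"
  unfolding bilinear_conv_bounded_bilinear[symmetric] bilinear_def
  by (auto intro!: linearI simp: vec_eq_iff algebra_simps)

lemma lift_exists:
  fixes y :: "complex ^ 'n::finite"
  assumes "y $ i \<noteq> 0"
  shows "\<exists>s D. (\<forall>\<^sub>F y' in nhds y. s y' \<in> blowdown (chart_inv i y')) \<and> (s has_derivative D) (at y)"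
proof -
  define n where "n = CARD('n)"
  have n: "n > 0" unfolding n_def by simp
  define \<beta> where "\<beta> z = exp (Ln (y $ i) / n) * exp (Ln (z / y $ i) / n)" for z
  have "(exp (Ln (y $ i) / n) * exp (Ln (z / y $ i) / n)) ^ n = z" if "z \<noteq> 0" for z
    using n assms that by (simp add: power_mult_distrib exp_of_nat_mult[symmetric])
  then have 1: "\<beta> (y' $ i) *s affine_part i y' \<in> blowdown (chart_inv i y')" if "y' $ i \<noteq> 0" for y'
    using that unfolding blowdown_chart_inv \<beta>_def n_def by blast
  have "open {y'::complex^'n. y' $ i \<noteq> 0}"
    by (intro open_Collect_neq continuous_intros)
  then have 2: "\<forall>\<^sub>F y' in nhds y. y' $ i \<noteq> 0"
    using assms by (auto simp: eventually_nhds)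
  have "\<exists>d. (\<beta> has_field_derivative d) (at (y $ i))"
    unfolding \<beta>_def using assms n
    by (intro exI) (rule derivative_eq_intros refl | simp)+
  then obtain d where "(\<beta> has_field_derivative d) (at (y $ i))" ..
  then have "((\<lambda>y'. \<beta> (y' $ i)) has_derivative (\<lambda>v. d * (v $ i))) (at y)"
    unfolding has_field_derivative_def
    by (rule has_derivative_compose[rotated])
       (rule bounded_linear_imp_has_derivative[OF bounded_linear_vec_nth])
  note D = bounded_bilinear.FDERIV[OF bounded_bilinear_vector_smult this affine_part_deriv[of i]]
  show ?thesis
    by (rule exI, rule exI, rule conjI[OF eventually_mono[OF 2 1] D])
qed

lemma lift_deriv:
  fixes y :: "complex ^ 'n::finite"
  assumes y: "y $ i \<noteq> 0"
    and ev: "\<forall>\<^sub>F y' in nhds y. s y' \<in> blowdown (chart_inv i y')"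
    and D: "(s has_derivative D) (at y)"
  obtains b where "b ^ CARD('n) = y $ i" "s y = b *s affine_part i y"
    "\<And>v. D v = b *s (fibre_part i v + (v $ i / (CARD('n) * y $ i)) *s affine_part i y)"
proof -
  define n where "n = CARD('n)"
  have n: "n > 0" unfolding n_def by simp
  define \<beta> where "\<beta> y' = s y' $ i" for y'
  have ev': "\<forall>\<^sub>F y' in nhds y. \<beta> y' ^ n = y' $ i \<and> s y' = \<beta> y' *s affine_part i y'"
    using ev by eventually_elim (auto simp: blowdown_chart_inv \<beta>_def n_def)
  then have evat: "\<forall>\<^sub>F y' in at y. \<beta> y' ^ n = y' $ i \<and> s y' = \<beta> y' *s affine_part i y'"
    and at: "\<beta> y ^ n = y $ i" "s y = \<beta> y *s affine_part i y"
    by (auto simp: eventually_nhds_conv_at)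
  have nz: "\<beta> y \<noteq> 0" using at(1) y n by (auto simp: zero_power)
  have D\<beta>: "(\<beta> has_derivative (\<lambda>v. D v $ i)) (at y)"
    unfolding \<beta>_def by (rule bounded_linear.has_derivative[OF bounded_linear_vec_nth D])
  have "((\<lambda>y'. \<beta> y' ^ n) has_derivative (\<lambda>v. of_nat n * D v $ i * \<beta> y ^ (n - 1))) (at y)"
    by (rule has_derivative_power[OF D\<beta>])
  moreover have "((\<lambda>y'. \<beta> y' ^ n) has_derivative (\<lambda>v. v $ i)) (at y)"
  proof (rule has_derivative_transform_eventually)
    show "((\<lambda>y'. y' $ i) has_derivative (\<lambda>v. v $ i)) (at y)"
      by (rule bounded_linear_imp_has_derivative[OF bounded_linear_vec_nth])
    show "\<forall>\<^sub>F y' in at y. y' $ i = \<beta> y' ^ n"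
      using evat by eventually_elim simp
  qed (use at in auto)
  ultimately have eq: "(\<lambda>v. of_nat n * D v $ i * \<beta> y ^ (n - 1)) = (\<lambda>v. v $ i)"
    by (rule has_derivative_unique)
  have Di: "D v $ i = \<beta> y * (v $ i / (n * y $ i))" for v
  proof -
    have "\<beta> y ^ n = \<beta> y * \<beta> y ^ (n - 1)" using n by (cases n) auto
    then show ?thesis
      using fun_cong[OF eq, of v] nz n unfolding at(1)[symmetric]
      by (simp add: divide_simps) (simp add: algebra_simps)
  qed
  have "(s has_derivative (\<lambda>v. \<beta> y *s fibre_part i v + D v $ i *s affine_part i y)) (at y)"
  proof (rule has_derivative_transform_eventually)
    show "((\<lambda>y'. \<beta> y' *s affine_part i y') has_derivative
       (\<lambda>v. \<beta> y *s fibre_part i v + D v $ i *s affine_part i y)) (at y)"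
      by (rule bounded_bilinear.FDERIV[OF bounded_bilinear_vector_smult D\<beta> affine_part_deriv])
    show "\<forall>\<^sub>F y' in at y. \<beta> y' *s affine_part i y' = s y'"
      using evat by eventually_elim simp
  qed (use at in auto)
  then have "D = (\<lambda>v. \<beta> y *s fibre_part i v + D v $ i *s affine_part i y)"
    using D by (rule has_derivative_unique[rotated])
  then have "D v = \<beta> y *s fibre_part i v + D v $ i *s affine_part i y" for v
    by (rule fun_cong)
  then have "D v = \<beta> y *s (fibre_part i v + (v $ i / (n * y $ i)) *s affine_part i y)" for v
    unfolding Di by (simp add: vec_eq_iff algebra_simps)
  with at show ?thesis using that unfolding n_def by blast
qed

lemma norm_vector_smult: "norm (c *s x) = norm c * norm (x :: complex ^ 'n::finite)"
proof -
  have "complex_of_real ((norm (c *s x))\<^sup>2) = of_real ((norm c * norm x)\<^sup>2)"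
    unfolding herm_self[symmetric] herm_scale_left herm_scale_right power_mult_distrib of_real_mult
      complex_norm_square[of c]
    by (simp only: herm_self mult_ac)
  then have "(norm (c *s x))\<^sup>2 = (norm c * norm x)\<^sup>2" using of_real_eq_iff by blast
  then show ?thesis by (simp add: power2_eq_iff_nonneg)
qed

lemma ceh_flat_lift:
  fixes y :: "complex ^ 'n::finite"
  assumes a: "a > 0" and y: "y $ i \<noteq> 0" and b: "b ^ CARD('n) = y $ i"
  shows "ceh_flat a (b *s affine_part i y)
      (b *s (fibre_part i v + (v $ i / (CARD('n) * y $ i)) *s affine_part i y))
      (b *s (fibre_part i v' + (v' $ i / (CARD('n) * y $ i)) *s affine_part i y)) =
    ceh_closed a i y v v'"
proof -
  define n where "n = CARD('n)"
  have n: "n > 0" unfolding n_def by simp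
  define \<zeta> where "\<zeta> = affine_part i y"
  define r where "r = (norm \<zeta>)\<^sup>2"
  have r: "r > 0" unfolding r_def \<zeta>_def by simp
  define t where "t = y $ i"
  define \<kappa> where "\<kappa> = v $ i / (n * t)"
  define \<kappa>' where "\<kappa>' = v' $ i / (n * t)"
  define \<eta> where "\<eta> = fibre_part i v"
  define \<eta>' where "\<eta>' = fibre_part i v'"
  define B where "B = (norm b)\<^sup>2"
  have b0: "b \<noteq> 0" using b y by (auto simp: zero_power)
  then have B: "B > 0" unfolding B_def by simp
  have Bc: "b * cnj b = of_real B" "cnj b * b = of_real B"
    unfolding B_def complex_norm_square by (simp_all add: mult.commute)
  define u where "u = B * r"
  have u: "u > 0" unfolding u_def using B r by simp
  have nu: "(norm (b *s \<zeta>))\<^sup>2 = u"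
    by (simp add: u_def B_def r_def norm_vector_smult power_mult_distrib)
  define H where "H = a ^ n + u ^ n"
  have H: "H > 0" unfolding H_def using a u by (simp add: add_pos_pos)
  have "(norm t)\<^sup>2 = B ^ n"
    unfolding B_def t_def b[symmetric] n_def by (simp add: norm_power power_mult[symmetric] mult.commute)
  then have tH: "(norm t)\<^sup>2 * r ^ n = u ^ n" unfolding u_def by (simp add: power_mult_distrib)
  define P where "P = herm \<eta> \<zeta>"
  define P' where "P' = herm \<eta>' \<zeta>"
  define E where "E = herm \<eta> \<eta>'"
  have zz: "herm \<zeta> \<zeta> = of_real r" unfolding r_def by (rule herm_self)
  have cP: "herm \<zeta> \<eta>' = cnj P'" unfolding P'_def by (simp add: herm_cnj)
  define W where "W = (P + \<kappa> * r) * cnj (P' + \<kappa>' * r)"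
  define R where "R = root n H"
  have root: "root n (1 + a ^ n / u ^ n) = R / u"
  proof -
    have "1 + a ^ n / u ^ n = H / u ^ n" unfolding H_def using u by (simp add: field_simps)
    then show ?thesis unfolding R_def using u n by (simp add: real_root_divide real_root_power_cancel)
  qed
  have h1: "herm (b *s (\<eta> + \<kappa> *s \<zeta>)) (b *s (\<eta>' + \<kappa>' *s \<zeta>)) =
      of_real B * (E + \<kappa> * cnj P' + cnj \<kappa>' * P + \<kappa> * cnj \<kappa>' * r)"
    unfolding herm_scale_left herm_scale_right herm_add_left herm_add_right zz cP
      P_def[symmetric] E_def[symmetric] Bc(1)[symmetric]
    by (simp add: algebra_simps)
  have h2: "herm (b *s (\<eta> + \<kappa> *s \<zeta>)) (b *s \<zeta>) = of_real B * (P + \<kappa> * r)"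
    unfolding herm_scale_left herm_scale_right herm_add_left herm_add_right zz
      P_def[symmetric] Bc(1)[symmetric]
    by (simp add: algebra_simps)
  have h3: "herm (b *s \<zeta>) (b *s (\<eta>' + \<kappa>' *s \<zeta>)) = of_real B * cnj (P' + \<kappa>' * r)"
    unfolding herm_scale_left herm_scale_right herm_add_left herm_add_right zz cP
      Bc(1)[symmetric]
    by (simp add: algebra_simps)
  have th: "t * P + of_real (r / n) * v $ i = t * (P + \<kappa> * r)"
    "t * P' + of_real (r / n) * v' $ i = t * (P' + \<kappa>' * r)"
    unfolding \<kappa>_def \<kappa>'_def using n y by (simp_all add: t_def field_simps)
  have th2: "of_real (r ^ n / (r\<^sup>2 * H)) * ((t * (P + \<kappa> * r)) * cnj (t * (P' + \<kappa>' * r))) =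
     of_real (u ^ n / (r\<^sup>2 * H)) * W"
  proof -
    have "(t * (P + \<kappa> * r)) * cnj (t * (P' + \<kappa>' * r)) = of_real ((norm t)\<^sup>2) * W"
      unfolding W_def complex_norm_square by (simp add: algebra_simps)
    then show ?thesis unfolding tH[symmetric] by (simp add: algebra_simps)
  qed
  have ub: "of_real (a ^ n / H / u) * (of_real B * (P + \<kappa> * r) * (of_real B * cnj (P' + \<kappa>' * r))) =
     of_real B * (of_real (a ^ n / (H * r)) * W)"
  proof -
    have "a ^ n / H / u * B * B = B * (a ^ n / (H * r))"
      unfolding u_def using B by simp
    then have "complex_of_real (a ^ n / H / u * B * B) = of_real (B * (a ^ n / (H * r)))"
      by (rule arg_cong)
    then have "of_real (a ^ n / H / u * B * B) * W = of_real (B * (a ^ n / (H * r))) * W"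
      by (rule arg_cong)
    then show ?thesis unfolding W_def of_real_mult by (simp only: mult_ac)
  qed
  have aH: "a ^ n / (H * r) = 1 / r - u ^ n / (H * r)"
  proof -
    have "a ^ n / (H * r) = H / (H * r) - u ^ n / (H * r)"
      unfolding diff_divide_distrib[symmetric] by (simp add: H_def)
    then show ?thesis using H by simp
  qed
  have key: "of_real B * (E + \<kappa> * cnj P' + cnj \<kappa>' * P + \<kappa> * cnj \<kappa>' * r)
       - of_real B * (of_real (a ^ n / (H * r)) * W)
     = of_real u * (E / of_real r - P * cnj P' / of_real (r\<^sup>2) + of_real (u ^ n / (r\<^sup>2 * H)) * W)"
  proof -
    have "E + \<kappa> * cnj P' + cnj \<kappa>' * P + \<kappa> * cnj \<kappa>' * r - of_real (1 / r) * W
        = of_real r * (E / of_real r - P * cnj P' / of_real (r\<^sup>2))"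
      unfolding W_def using r by (simp add: field_simps power2_eq_square)
    moreover have "of_real (u ^ n / (H * r)) * W = of_real r * (of_real (u ^ n / (r\<^sup>2 * H)) * W)"
      using r H by (simp add: field_simps power2_eq_square)
    ultimately have "E + \<kappa> * cnj P' + cnj \<kappa>' * P + \<kappa> * cnj \<kappa>' * r - of_real (a ^ n / (H * r)) * W
        = of_real r * (E / of_real r - P * cnj P' / of_real (r\<^sup>2) + of_real (u ^ n / (r\<^sup>2 * H)) * W)"
      unfolding aH by (simp only: of_real_diff left_diff_distrib distrib_left) (simp add: algebra_simps)
    then have "of_real B * (E + \<kappa> * cnj P' + cnj \<kappa>' * P + \<kappa> * cnj \<kappa>' * r - of_real (a ^ n / (H * r)) * W)
        = of_real B * (of_real r * (E / of_real r - P * cnj P' / of_real (r\<^sup>2) + of_real (u ^ n / (r\<^sup>2 * H)) * W))"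
      by (rule arg_cong)
    then show ?thesis unfolding u_def of_real_mult by (simp only: right_diff_distrib mult.assoc)
  qed
  have "ceh_flat a (b *s \<zeta>) (b *s (\<eta> + \<kappa> *s \<zeta>)) (b *s (\<eta>' + \<kappa>' *s \<zeta>)) =
     R / u * Re (of_real u * (E / of_real r - P * cnj P' / of_real (r\<^sup>2) + of_real (u ^ n / (r\<^sup>2 * H)) * W))"
    unfolding ceh_flat_herm Let_def nu n_def[symmetric] H_def[symmetric] h1 h2 h3 ub key root ..
  also have "\<dots> = R * Re (E / of_real r - P * cnj P' / of_real (r\<^sup>2) + of_real (u ^ n / (r\<^sup>2 * H)) * W)"
    using u by simp
  also have "\<dots> = ceh_closed a i y v v'"
    unfolding ceh_closed_def Let_def \<zeta>_def[symmetric] t_def[symmetric] r_def[symmetric]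
      n_def[symmetric] tH H_def[symmetric] \<eta>_def[symmetric] \<eta>'_def[symmetric]
      P_def[symmetric] P'_def[symmetric] E_def[symmetric] R_def[symmetric] th th2 ..
  finally show ?thesis
    unfolding \<zeta>_def \<eta>_def \<eta>'_def \<kappa>_def \<kappa>'_def t_def n_def .
qed

lemma ceh_pullback_closed:
  assumes "a > 0" "y $ i \<noteq> 0"
  shows "ceh_pullback a i y v v' = ceh_closed a i y v v'"
proof -
  have val: "ceh_flat a (s y) (D v) (D v') = ceh_closed a i y v v'"
    if lift: "\<forall>\<^sub>F y' in nhds y. s y' \<in> blowdown (chart_inv i y')" "(s has_derivative D) (at y)" for s D
  proof -
    obtain b where b: "b ^ CARD('a) = y $ i" "s y = b *s affine_part i y"
      "\<And>v. D v = b *s (fibre_part i v + (v $ i / (CARD('a) * y $ i)) *s affine_part i y)"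
      using lift_deriv[OF assms(2) lift] by blast
    show ?thesis
      unfolding b(2,3) by (rule ceh_flat_lift[OF assms b(1)])
  qed
  obtain s D where s: "\<forall>\<^sub>F y' in nhds y. s y' \<in> blowdown (chart_inv i y')"
    "(s has_derivative D) (at y)"
    using lift_exists[OF assms(2)] by blast
  show ?thesis
    unfolding ceh_pullback_def
  proof (rule the_equality)
    show "\<exists>s D. (\<forall>\<^sub>F y' in nhds y. s y' \<in> blowdown (chart_inv i y')) \<and>
        (s has_derivative D) (at y) \<and> ceh_closed a i y v v' = ceh_flat a (s y) (D v) (D v')"
      by (intro exI[of _ s] exI[of _ D] conjI s val[OF s, symmetric])
  next
    fix c
    assume "\<exists>s D. (\<forall>\<^sub>F y' in nhds y. s y' \<in> blowdown (chart_inv i y')) \<and>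
        (s has_derivative D) (at y) \<and> c = ceh_flat a (s y) (D v) (D v')"
    then show "c = ceh_closed a i y v v'"
      by (elim exE conjE) (simp only: val)
  qed
qed

lemma tendsto_closed_aux:
  fixes R H :: "'a \<Rightarrow> real" and p p' q q' :: "'a \<Rightarrow> complex"
  assumes lims: "(R \<longlongrightarrow> R0) F" "(H \<longlongrightarrow> H0) F" "(p \<longlongrightarrow> p0) F" "(p' \<longlongrightarrow> p0') F"
     "(q \<longlongrightarrow> q0) F" "(q' \<longlongrightarrow> q0') F"
    and nz: "R0 \<noteq> 0" "H0 \<noteq> 0"
  shows "((\<lambda>y. root n (H y) * Re (E / of_real (R y) - p y * cnj (p' y) / of_real ((R y)\<^sup>2)
      + of_real ((R y) ^ n / ((R y)\<^sup>2 * H y)) * (q y * cnj (q' y)))) \<longlongrightarrow>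
    root n H0 * Re (E / of_real R0 - p0 * cnj p0' / of_real (R0\<^sup>2)
      + of_real (R0 ^ n / (R0\<^sup>2 * H0)) * (q0 * cnj q0'))) F"
proof -
  have nz': "complex_of_real R0 \<noteq> 0" "complex_of_real (R0\<^sup>2) \<noteq> 0" "R0\<^sup>2 * H0 \<noteq> 0"
    using nz by auto
  have 1: "((\<lambda>y. root n (H y)) \<longlongrightarrow> root n H0) F"
    by (rule tendsto_real_root) (rule lims)
  have 2: "((\<lambda>y. E / of_real (R y)) \<longlongrightarrow> E / of_real R0) F"
    by (rule tendsto_divide tendsto_const tendsto_of_real lims nz')+
  have 3: "((\<lambda>y. p y * cnj (p' y) / of_real ((R y)\<^sup>2)) \<longlongrightarrow> p0 * cnj p0' / of_real (R0\<^sup>2)) F"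
    by (rule tendsto_divide tendsto_mult tendsto_cnj tendsto_of_real tendsto_power lims nz')+
  have 4: "((\<lambda>y. of_real ((R y) ^ n / ((R y)\<^sup>2 * H y)) * (q y * cnj (q' y))) \<longlongrightarrow>
      of_real (R0 ^ n / (R0\<^sup>2 * H0)) * (q0 * cnj q0')) F"
    by (rule tendsto_mult tendsto_of_real tendsto_divide tendsto_power tendsto_cnj lims nz')+
  show ?thesis
    by (rule tendsto_mult 1 tendsto_Re tendsto_add tendsto_diff 2 3 4)+
qed

theorem ceh_metric_closed_form:
  fixes y :: "complex ^ 'n::finite"
  assumes "a > 0"
  shows "ceh_metric a i y v v' = ceh_closed a i y v v'"
proof (cases "y $ i = 0")
  case False
  then show ?thesis using assms by (simp add: ceh_metric_def ceh_pullback_closed)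
next
  case True
  have pos: "a ^ CARD('n) + (norm (y $ i))\<^sup>2 * ((norm (affine_part i y))\<^sup>2) ^ CARD('n) \<noteq> 0"
    using assms by (simp add: add_pos_nonneg less_imp_neq[symmetric])
  have aff: "(affine_part i \<longlongrightarrow> affine_part i y) (at y)"
    using has_derivative_continuous[OF affine_part_deriv] by (simp add: continuous_at)
  have t: "((\<lambda>y. y $ i) \<longlongrightarrow> y $ i) (at y)"
    by (rule tendsto_vec_nth tendsto_ident_at)+
  have R: "((\<lambda>y. (norm (affine_part i y))\<^sup>2) \<longlongrightarrow> (norm (affine_part i y))\<^sup>2) (at y)"
    by (rule tendsto_power tendsto_norm aff)+
  have h: "((\<lambda>y. herm x (affine_part i y)) \<longlongrightarrow> herm x (affine_part i y)) (at y)" for x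
    unfolding herm_def
    by (rule tendsto_sum tendsto_mult tendsto_const tendsto_cnj tendsto_vec_nth aff)+
  have q: "complex_of_real (real CARD('n)) \<noteq> 0" "real CARD('n) \<noteq> 0" by simp_all
  have Q: "((\<lambda>y. y $ i * herm (fibre_part i u) (affine_part i y) +
        of_real ((norm (affine_part i y))\<^sup>2 / CARD('n)) * u $ i) \<longlongrightarrow>
      y $ i * herm (fibre_part i u) (affine_part i y) +
        of_real ((norm (affine_part i y))\<^sup>2 / CARD('n)) * u $ i) (at y)" for u
    by (rule tendsto_add tendsto_const tendsto_mult tendsto_of_real tendsto_divide R q h t)+
  have "((\<lambda>y. ceh_closed a i y v v') \<longlongrightarrow> ceh_closed a i y v v') (at y)"
    unfolding ceh_closed_def Let_def
  proof (rule tendsto_closed_aux)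
    show "(norm (affine_part i y))\<^sup>2 \<noteq> 0" by simp
    show "a ^ CARD('n) + (norm (y $ i))\<^sup>2 * ((norm (affine_part i y))\<^sup>2) ^ CARD('n) \<noteq> 0"
      by (rule pos)
    show "((\<lambda>y. a ^ CARD('n) + (norm (y $ i))\<^sup>2 * ((norm (affine_part i y))\<^sup>2) ^ CARD('n)) \<longlongrightarrow>
        a ^ CARD('n) + (norm (y $ i))\<^sup>2 * ((norm (affine_part i y))\<^sup>2) ^ CARD('n)) (at y)"
      by (rule tendsto_add tendsto_const tendsto_mult R tendsto_power tendsto_norm t)+
  qed (rule R h Q)+
  then have "((\<lambda>y. ceh_closed a i y v v') \<longlongrightarrow> ceh_closed a i y v v') (at y within {y'. y' $ i \<noteq> 0})"
    by (rule tendsto_within_subset) simp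
  moreover have "\<forall>\<^sub>F y' in at y within {y'. y' $ i \<noteq> 0}.
      ceh_closed a i y' v v' = ceh_pullback a i y' v v'"
    using assms by (auto simp: eventually_at_filter ceh_pullback_closed)
  ultimately have lim: "((\<lambda>y. ceh_pullback a i y v v') \<longlongrightarrow> ceh_closed a i y v v')
      (at y within {y'. y' $ i \<noteq> 0})"
    by (rule Lim_transform_eventually)
  have "y islimpt {y'. y' $ i \<noteq> 0}"
  proof (unfold islimpt_approachable, intro allI impI)
    fix e :: real assume e: "e > 0"
    define y' where "y' = y + complex_of_real (e / 2) *s axis i 1"
    have nz: "y' $ i \<noteq> 0" using True e by (simp add: y'_def axis_def)
    have ax: "norm (axis i 1 :: complex ^ 'n) = 1"
      by (simp add: norm_vec_def L2_set_def axis_def if_distrib[of norm] if_distrib[of "\<lambda>x. x\<^sup>2"]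
          cong: if_cong)
    have "dist y' y < e"
      using e ax by (simp add: y'_def dist_norm norm_vector_smult)
    with nz show "\<exists>y'\<in>{y'. y' $ i \<noteq> 0}. y' \<noteq> y \<and> dist y' y < e"
      using True by auto
  qed
  then have "at y within {y'. y' $ i \<noteq> 0} \<noteq> bot"
    by (simp add: trivial_limit_within)
  from tendsto_Lim[OF this lim] show ?thesis using True by (simp add: ceh_metric_def)
qed


section \<open>Submanifolds and mean curvature\<close>

primrec Ck_on ::
    "nat \<Rightarrow> 'a::euclidean_space set \<Rightarrow> ('a \<Rightarrow> 'b::real_normed_vector) \<Rightarrow> bool" where
  "Ck_on 0 S f \<longleftrightarrow> continuous_on S f"
| "Ck_on (Suc k) S f \<longleftrightarrow> (\<forall>x\<in>S. f differentiable (at x)) \<and>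
     (\<forall>v. Ck_on k S (\<lambda>x. frechet_derivative f (at x) v))"

definition smooth_on :: "'a::euclidean_space set \<Rightarrow> ('a \<Rightarrow> 'b::real_normed_vector) \<Rightarrow> bool" where
  "smooth_on S f \<longleftrightarrow> (\<forall>k. Ck_on k S f)"

definition local_parametrization ::
    "'a::euclidean_space set \<Rightarrow> 'a set \<Rightarrow> (real ^ 'k::finite) set \<Rightarrow> (real ^ 'k \<Rightarrow> 'a) \<Rightarrow> bool" where
  "local_parametrization M V D f \<longleftrightarrow>
     open V \<and> open D \<and> smooth_on D f \<and>
     (\<forall>x\<in>D. inj (frechet_derivative f (at x))) \<and>
     (\<exists>g. homeomorphism D (M \<inter> V) f g)"

text \<open>Embedded submanifolds of a Euclidean space, without boundary, of dimension \<open>CARD('k)\<close>.\<close>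

definition submanifold_euclidean :: "'k::finite itself \<Rightarrow> 'a::euclidean_space set \<Rightarrow> bool" where
  "submanifold_euclidean K M \<longleftrightarrow>
     (\<forall>p\<in>M. \<exists>V D (f :: real ^ 'k \<Rightarrow> 'a). p \<in> V \<and> local_parametrization M V D f)"

text \<open>
  In what follows \<open>G x\<close> is the inner product at \<open>x\<close> of a Riemannian metric on a Euclidean space,
  and \<open>christoffel G x v w\<close> is the value at \<open>x\<close> of the Levi-Civita covariant derivative of the
  constant vector field \<open>w\<close> in direction \<open>v\<close>, given by the Koszul formula.
\<close>

definition dir_deriv ::
    "('a::real_normed_vector \<Rightarrow> 'b::real_normed_vector) \<Rightarrow> 'a \<Rightarrow> 'a \<Rightarrow> 'b" where
  "dir_deriv f x v = frechet_derivative f (at x) v"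

definition christoffel ::
    "('a::euclidean_space \<Rightarrow> 'a \<Rightarrow> 'a \<Rightarrow> real) \<Rightarrow> 'a \<Rightarrow> 'a \<Rightarrow> 'a \<Rightarrow> 'a" where
  "christoffel G x v w = (THE c. \<forall>e. 2 * G x c e =
     dir_deriv (\<lambda>x. G x w e) x v + dir_deriv (\<lambda>x. G x v e) x w - dir_deriv (\<lambda>x. G x v w) x e)"

definition normal_part :: "('a::euclidean_space \<Rightarrow> 'a \<Rightarrow> real) \<Rightarrow> 'a set \<Rightarrow> 'a \<Rightarrow> 'a" where
  "normal_part g T A = (THE N. A - N \<in> T \<and> (\<forall>\<tau>\<in>T. g N \<tau> = 0))"

definition partial_deriv :: "(real ^ 'k::finite \<Rightarrow> 'a::euclidean_space) \<Rightarrow> 'k \<Rightarrow> real ^ 'k \<Rightarrow> 'a" where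
  "partial_deriv f \<alpha> x = dir_deriv f x (axis \<alpha> 1)"

definition induced_metric ::
    "('a::euclidean_space \<Rightarrow> 'a \<Rightarrow> 'a \<Rightarrow> real) \<Rightarrow> (real ^ 'k::finite \<Rightarrow> 'a) \<Rightarrow> real ^ 'k
      \<Rightarrow> real ^ 'k ^ 'k" where
  "induced_metric G f x = (\<chi> \<alpha> \<beta>. G (f x) (partial_deriv f \<alpha> x) (partial_deriv f \<beta> x))"

definition second_fundamental_form ::
    "('a::euclidean_space \<Rightarrow> 'a \<Rightarrow> 'a \<Rightarrow> real) \<Rightarrow> (real ^ 'k::finite \<Rightarrow> 'a) \<Rightarrow> real ^ 'k
      \<Rightarrow> 'k \<Rightarrow> 'k \<Rightarrow> 'a" where
  "second_fundamental_form G f x \<alpha> \<beta> =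
     normal_part (G (f x)) (range (frechet_derivative f (at x)))
       (partial_deriv (partial_deriv f \<beta>) \<alpha> x +
        christoffel G (f x) (partial_deriv f \<alpha> x) (partial_deriv f \<beta> x))"

definition mean_curvature ::
    "('a::euclidean_space \<Rightarrow> 'a \<Rightarrow> 'a \<Rightarrow> real) \<Rightarrow> (real ^ 'k::finite \<Rightarrow> 'a) \<Rightarrow> real ^ 'k \<Rightarrow> 'a" where
  "mean_curvature G f x = (\<Sum>\<alpha>\<in>UNIV. \<Sum>\<beta>\<in>UNIV.
     matrix_inv (induced_metric G f x) $ \<alpha> $ \<beta> *\<^sub>R second_fundamental_form G f x \<alpha> \<beta>)"

definition minimal_euclidean ::
    "('a::euclidean_space \<Rightarrow> 'a \<Rightarrow> 'a \<Rightarrow> real) \<Rightarrow> 'k::finite itself \<Rightarrow> 'a set \<Rightarrow> bool" where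
  "minimal_euclidean G K M \<longleftrightarrow>
     (\<forall>V D (f :: real ^ 'k \<Rightarrow> 'a). local_parametrization M V D f \<longrightarrow>
        (\<forall>x\<in>D. mean_curvature G f x = 0))"

text \<open>The smooth structure and the metric of the total space are those of its charts.\<close>

definition submanifold ::
    "'k::finite itself \<Rightarrow> ((complex ^ 'n::finite) \<times> 'n cproj) set \<Rightarrow> bool" where
  "submanifold K \<Sigma> \<longleftrightarrow> \<Sigma> \<subseteq> total_space \<and>
     (\<forall>i. submanifold_euclidean K (chart i ` (\<Sigma> \<inter> chart_dom i)))"

definition minimal ::
    "real \<Rightarrow> 'k::finite itself \<Rightarrow> ((complex ^ 'n::finite) \<times> 'n cproj) set \<Rightarrow> bool" where
  "minimal a K \<Sigma> \<longleftrightarrow>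
     (\<forall>i. minimal_euclidean (ceh_metric a i) K (chart i ` (\<Sigma> \<inter> chart_dom i)))"

end

theory Submission
  imports Defs
begin

text \<open>
  On a compact submanifold \<open>\<Sigma>\<close> the radius \<open>u = \<bar>w\<bar>\<^sup>2\<close> attains its maximum. Suppose that it is positive.
  At a maximum point the tangent space of \<open>\<Sigma>\<close> lies in that of the level set of \<open>u\<close>, and minimality says
  that the trace over it of the Hessian of \<open>u\<close> is the Laplacian of \<open>u\<close> on \<open>\<Sigma>\<close>, which is at most zero.
  But the level sets of positive radius are strictly convex: the metric is \<open>(a\<^sup>n + u\<^sup>n)\<^bsup>1/n\<^esup>\<close> times the
  Fubini-Study metric plus a multiple \<open>u\<^sup>n (a\<^sup>n + u\<^sup>n)\<^bsup>1/n - 1\<^esup>\<close> of a fixed form in the fibre direction, and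
  both factors strictly increase with \<open>u\<close>.
\<close>

section \<open>Positive definite bilinear forms\<close>

definition pos_def_form :: "('a::real_vector \<Rightarrow> 'a \<Rightarrow> real) \<Rightarrow> bool" where
  "pos_def_form g \<longleftrightarrow> bilinear g \<and> (\<forall>v w. g v w = g w v) \<and> (\<forall>v. v \<noteq> 0 \<longrightarrow> g v v > 0)"

lemma pos_def_formD:
  assumes "pos_def_form g"
  shows "bilinear g" "g v w = g w v" "v \<noteq> 0 \<Longrightarrow> g v v > 0"
  using assms by (auto simp: pos_def_form_def)

lemma bilinear_lsum: "bilinear g \<Longrightarrow> g (\<Sum>x\<in>S. h x) y = (\<Sum>x\<in>S. g (h x) y)"
  using linear_sum[of "\<lambda>x. g x y" h S] by (simp add: bilinear_def o_def)

lemma bilinear_rsum: "bilinear g \<Longrightarrow> g x (\<Sum>y\<in>S. h y) = (\<Sum>y\<in>S. g x (h y))"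
  using linear_sum[of "g x" h S] by (simp add: bilinear_def o_def)

text \<open>Gram-Schmidt for \<open>g\<close>. Orthonormality is recorded only through the expansion
  it yields, the form in which the set serves for projections, representing vectors and
  traces.\<close>

lemma pos_def_form_expansion_span:
  fixes g :: "'a::real_vector \<Rightarrow> 'a \<Rightarrow> real"
  assumes g: "pos_def_form g" and "finite F"
  shows "\<exists>S. finite S \<and> S \<subseteq> span F \<and> (\<forall>x\<in>span F. x = (\<Sum>e\<in>S. g x e *\<^sub>R e))"
  using \<open>finite F\<close>
proof (induction F)
  case empty
  show ?case by (intro exI[of _ "{}"]) auto
next
  case (insert v F)
  note bil = pos_def_formD(1)[OF g]
  from insert.IH obtain S where S: "finite S" "S \<subseteq> span F"
    "\<And>x. x \<in> span F \<Longrightarrow> x = (\<Sum>e\<in>S. g x e *\<^sub>R e)" by blast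
  define w where "w = v - (\<Sum>e\<in>S. g v e *\<^sub>R e)"
  have p: "(\<Sum>e\<in>S. g v e *\<^sub>R e) \<in> span F"
    using S(2) by (intro span_sum span_scale) auto
  have sub: "span F \<subseteq> span (insert v F)" by (rule span_mono) auto
  \<comment> \<open>\<open>w\<close> is \<open>v\<close> minus its \<open>g\<close>-projection to
    \<open>span F\<close>; expanding \<open>x\<close> over \<open>S\<close> makes the two terms
    cancel.\<close>
  have orth: "g w x = 0" if "x \<in> span F" for x
  proof -
    have "g w x = g v x - (\<Sum>e\<in>S. g v e * g e x)"
      unfolding w_def
      by (simp add: bilinear_lsub[OF bil] bilinear_lsum[OF bil] bilinear_lmul[OF bil])
    also have "(\<Sum>e\<in>S. g v e * g e x) = g v (\<Sum>e\<in>S. g x e *\<^sub>R e)"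
      by (simp add: bilinear_rsum[OF bil] bilinear_rmul[OF bil] pos_def_formD(2)[OF g, of x] mult.commute)
    finally show ?thesis using S(3)[OF that] by simp
  qed
  show ?case
  proof (cases "w = 0")
    case True
    then have "v \<in> span F" using p by (simp add: w_def)
    then have "span (insert v F) = span F" by (rule span_redundant)
    then show ?thesis using S by auto
  next
    case False
    then have gw: "g w w > 0" by (rule pos_def_formD(3)[OF g])
    define k where "k = 1 / sqrt (g w w)"
    define w' where "w' = k *\<^sub>R w"
    have k: "k * k * g w w = 1" "k > 0"
      using gw by (auto simp: k_def field_simps)
    \<comment> \<open>A member of \<open>S\<close> would be orthogonal to \<open>w\<close>. Being
      new, \<open>w'\<close> contributes its own term to the sum over
      \<open>insert w' S\<close>.\<close>
    have w'S: "w' \<notin> S"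
    proof
      assume "w' \<in> S"
      then have "g w w' = 0" using orth S(2) by blast
      then show False using k gw by (simp add: w'_def bilinear_rmul[OF bil])
    qed
    have wF: "w \<in> span (insert v F)"
      unfolding w_def using p sub by (intro span_diff) (auto intro: span_base)
    have "x = (\<Sum>e\<in>insert w' S. g x e *\<^sub>R e)" if "x \<in> span (insert v F)" for x
    proof -
      \<comment> \<open>Since \<open>v\<close> and \<open>w\<close> differ by an element of
        \<open>span F\<close>, the coefficient \<open>l\<close> found for \<open>v\<close> serves
        for \<open>w\<close> too.\<close>
      from that obtain l where "x - l *\<^sub>R v \<in> span F" by (auto simp: span_insert)
      then have y: "x - l *\<^sub>R w \<in> span F" (is "?y \<in> _")
      proof -
        have "x - l *\<^sub>R w = (x - l *\<^sub>R v) + l *\<^sub>R (\<Sum>e\<in>S. g v e *\<^sub>R e)"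
          by (simp add: w_def algebra_simps)
        then show ?thesis using \<open>x - l *\<^sub>R v \<in> span F\<close> p by (metis span_add span_scale)
      qed
      have x: "g x z = g ?y z + l * g w z" for z
        by (simp add: bilinear_lsub[OF bil] bilinear_lmul[OF bil])
      have "g x w' *\<^sub>R w' = l *\<^sub>R w"
      proof -
        have "g ?y w' = 0"
          using orth[OF y] pos_def_formD(2)[OF g, of w ?y] by (simp add: w'_def bilinear_rmul[OF bil])
        then have "g x w' *\<^sub>R w' = (l * (k * k * g w w)) *\<^sub>R w"
          unfolding x by (simp add: w'_def bilinear_rmul[OF bil] mult_ac)
        then show ?thesis by (simp add: k)
      qed
      moreover have "(\<Sum>e\<in>S. g x e *\<^sub>R e) = ?y"
        unfolding x using S(2) orth by (subst (2) S(3)[OF y]) (intro sum.cong; auto)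
      ultimately show ?thesis using S(1) w'S by simp
    qed
    moreover have "insert w' S \<subseteq> span (insert v F)"
      using S(2) sub wF by (auto simp: w'_def intro: span_scale)
    ultimately show ?thesis using S(1) by (intro exI[of _ "insert w' S"]) blast
  qed
qed

lemma pos_def_form_expansion:
  fixes g :: "'a::euclidean_space \<Rightarrow> 'a \<Rightarrow> real"
  assumes "pos_def_form g" "subspace T"
  obtains S where "finite S" "S \<subseteq> T" "\<And>x. x \<in> T \<Longrightarrow> x = (\<Sum>e\<in>S. g x e *\<^sub>R e)"
proof -
  obtain F where "independent F" "span F = T"
    using basis_exists[of T] assms(2) by (metis span_eq_iff span_superset span_mono subset_antisym)
  then have "\<exists>S. finite S \<and> S \<subseteq> T \<and> (\<forall>x\<in>T. x = (\<Sum>e\<in>S. g x e *\<^sub>R e))"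
    using pos_def_form_expansion_span[OF assms(1) independent_imp_finite] by fastforce
  then show ?thesis by (elim exE conjE, intro that) (assumption | drule bspec)+
qed

lemma pos_def_form_eqI:
  assumes g: "pos_def_form g" and "\<And>e. g c e = g d e"
  shows "c = d"
proof (rule ccontr)
  assume "c \<noteq> d"
  then have "g (c - d) (c - d) > 0" using pos_def_formD(3)[OF g] by simp
  then show False using assms(2) by (simp add: bilinear_lsub[OF pos_def_formD(1)[OF g]])
qed

text \<open>Riesz representation, with the values \<open>L e\<close> on the basis as coefficients.
  It supplies the vector that the Koszul formula is to determine.\<close>

lemma pos_def_form_represent:
  fixes g :: "'a::euclidean_space \<Rightarrow> 'a \<Rightarrow> real"
  assumes g: "pos_def_form g" and L: "linear L"
  shows "\<exists>c. \<forall>e. g c e = L e"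
proof -
  note bil = pos_def_formD(1)[OF g]
  obtain S where S: "finite S" "\<And>x. x = (\<Sum>e\<in>S. g x e *\<^sub>R e)"
    using pos_def_form_expansion[OF g subspace_UNIV] by auto
  have "g (\<Sum>e\<in>S. L e *\<^sub>R e) x = L x" for x
  proof -
    have "g (\<Sum>e\<in>S. L e *\<^sub>R e) x = (\<Sum>e\<in>S. g x e *\<^sub>R L e)"
      by (simp add: bilinear_lsum[OF bil] bilinear_lmul[OF bil] pos_def_formD(2)[OF g, of x] mult.commute)
    also have "\<dots> = L (\<Sum>e\<in>S. g x e *\<^sub>R e)"
      by (simp add: linear_sum[OF L] linear_cmul[OF L])
    finally show ?thesis by (simp only: S(2)[symmetric])
  qed
  then show ?thesis by blast
qed

text \<open>Orthogonal projection shows that exactly one vector fits the description in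
  \<open>normal_part\<close>. Tangency of the difference is what is kept: at the maximum
  \<open>N x\<close> is orthogonal to the tangent space, so a tangential change leaves the pairing
  with it intact.\<close>

lemma normal_part:
  fixes g :: "'a::euclidean_space \<Rightarrow> 'a \<Rightarrow> real"
  assumes g: "pos_def_form g" and T: "subspace T"
  shows "A - normal_part g T A \<in> T"
proof -
  note bil = pos_def_formD(1)[OF g]
  obtain S where S: "finite S" "S \<subseteq> T" "\<And>x. x \<in> T \<Longrightarrow> x = (\<Sum>e\<in>S. g x e *\<^sub>R e)"
    using pos_def_form_expansion[OF g T] by auto
  define N where "N = A - (\<Sum>e\<in>S. g A e *\<^sub>R e)"
  have "A - N \<in> T" unfolding N_def using S(2) T
    by (auto intro!: subspace_sum subspace_scale)
  moreover have "g N \<tau> = 0" if "\<tau> \<in> T" for \<tau>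
  proof -
    have "g N \<tau> = g A \<tau> - (\<Sum>e\<in>S. g A e * g e \<tau>)"
      unfolding N_def
      by (simp add: bilinear_lsub[OF bil] bilinear_lsum[OF bil] bilinear_lmul[OF bil])
    also have "(\<Sum>e\<in>S. g A e * g e \<tau>) = g A (\<Sum>e\<in>S. g \<tau> e *\<^sub>R e)"
      by (simp add: bilinear_rsum[OF bil] bilinear_rmul[OF bil] pos_def_formD(2)[OF g, of \<tau>] mult.commute)
    finally show ?thesis using S(3)[OF that] by simp
  qed
  ultimately have N: "A - N \<in> T \<and> (\<forall>\<tau>\<in>T. g N \<tau> = 0)" by blast
  have "A - (THE N. A - N \<in> T \<and> (\<forall>\<tau>\<in>T. g N \<tau> = 0)) \<in> T \<and>
    (\<forall>\<tau>\<in>T. g (THE N. A - N \<in> T \<and> (\<forall>\<tau>\<in>T. g N \<tau> = 0)) \<tau> = 0)"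
  proof (rule theI[of "\<lambda>N. A - N \<in> T \<and> (\<forall>\<tau>\<in>T. g N \<tau> = 0)", OF N])
    fix N' assume N': "A - N' \<in> T \<and> (\<forall>\<tau>\<in>T. g N' \<tau> = 0)"
    then have "(A - N) - (A - N') \<in> T" using N T by (blast intro: subspace_diff)
    then have "N' - N \<in> T" by simp
    then have "g (N' - N) (N' - N) = 0"
      using N N' by (simp add: bilinear_lsub[OF bil])
    then show "N' = N" using pos_def_formD(3)[OF g, of "N' - N"] by auto
  qed
  then show ?thesis unfolding normal_part_def by blast
qed

section \<open>Inverse Gram matrices and traces\<close>

lemma matrix_inv_unique:
  fixes A B :: "'a::semiring_1 ^ 'n ^ 'n"
  assumes "A ** B = mat 1" "B ** A = mat 1"
  shows "matrix_inv A = B"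
proof -
  have inv: "A ** matrix_inv A = mat 1 \<and> matrix_inv A ** A = mat 1"
    unfolding matrix_inv_def
    by (rule someI[of "\<lambda>A'. A ** A' = mat 1 \<and> A' ** A = mat 1" B]) (simp add: assms)
  have "matrix_inv A = (B ** A) ** matrix_inv A" by (simp only: assms(2) matrix_mul_lid)
  also have "\<dots> = B" by (simp only: matrix_mul_assoc[symmetric] inv matrix_mul_rid)
  finally show ?thesis .
qed

lemma axis_expand: "(\<Sum>\<alpha>\<in>UNIV. x $ \<alpha> *\<^sub>R axis \<alpha> (1::real)) = x"
  using basis_expansion[of x] by (simp add: scalar_mult_eq_scaleR)

text \<open>The inverse Gram matrix is the sum of \<open>e $ \<alpha> * e $ \<beta>\<close> over an
  orthonormal basis, so contracting it with \<open>B\<close> gives the sum of the diagonal values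
  \<open>B e e\<close>.\<close>

lemma trace_inverse_form:
  fixes g B :: "real ^ 'k::finite \<Rightarrow> real ^ 'k \<Rightarrow> real"
  assumes g: "pos_def_form g" and B: "bilinear B" and neg: "\<And>v. v \<noteq> 0 \<Longrightarrow> B v v < 0"
  shows "(\<Sum>\<alpha>\<in>UNIV. \<Sum>\<beta>\<in>UNIV. matrix_inv (\<chi> \<alpha> \<beta>. g (axis \<alpha> 1) (axis \<beta> 1)) $ \<alpha> $ \<beta> *
    B (axis \<alpha> 1) (axis \<beta> 1)) < 0"
proof -
  note bil = pos_def_formD(1)[OF g]
  obtain S where S: "finite S" "\<And>x. x = (\<Sum>e\<in>S. g x e *\<^sub>R e)"
    using pos_def_form_expansion[OF g subspace_UNIV] by auto
  define m :: "real^'k^'k" where "m = (\<chi> \<alpha> \<beta>. g (axis \<alpha> 1) (axis \<beta> 1))"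
  define A :: "real^'k^'k" where "A = (\<chi> \<alpha> \<beta>. \<Sum>e\<in>S. e $ \<alpha> * e $ \<beta>)"
  have "(m ** A) $ \<alpha> $ \<beta> = mat 1 $ \<alpha> $ \<beta>" for \<alpha> \<beta>
  proof -
    have "(m ** A) $ \<alpha> $ \<beta> = (\<Sum>\<gamma>\<in>UNIV. \<Sum>e\<in>S. g (axis \<alpha> 1) (axis \<gamma> 1) * (e $ \<gamma> * e $ \<beta>))"
      by (simp add: matrix_matrix_mult_def m_def A_def sum_distrib_left)
    also have "\<dots> = (\<Sum>e\<in>S. \<Sum>\<gamma>\<in>UNIV. g (axis \<alpha> 1) (axis \<gamma> 1) * (e $ \<gamma> * e $ \<beta>))"
      by (rule sum.swap)
    also have "\<dots> = (\<Sum>e\<in>S. g (axis \<alpha> 1) (\<Sum>\<gamma>\<in>UNIV. e $ \<gamma> *\<^sub>R axis \<gamma> 1) * e $ \<beta>)"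
      by (simp add: bilinear_rsum[OF bil] bilinear_rmul[OF bil] sum_distrib_left mult_ac)
    also have "\<dots> = (\<Sum>e\<in>S. g (axis \<alpha> 1) e *\<^sub>R e) $ \<beta>"
      by (simp add: axis_expand)
    also have "\<dots> = axis \<alpha> 1 $ \<beta>" by (simp only: S(2)[symmetric])
    finally show ?thesis by (simp add: mat_def axis_def)
  qed
  then have mA: "m ** A = mat 1" by (simp add: vec_eq_iff)
  then have "matrix_inv m = A" by (intro matrix_inv_unique) (auto simp: matrix_left_right_inverse)
  then have "(\<Sum>\<alpha>\<in>UNIV. \<Sum>\<beta>\<in>UNIV. matrix_inv m $ \<alpha> $ \<beta> * B (axis \<alpha> 1) (axis \<beta> 1)) =
     (\<Sum>\<alpha>\<in>UNIV. \<Sum>\<beta>\<in>UNIV. \<Sum>e\<in>S. e $ \<alpha> * e $ \<beta> * B (axis \<alpha> 1) (axis \<beta> 1))"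
    by (simp add: A_def sum_distrib_right)
  also have "\<dots> = (\<Sum>e\<in>S. \<Sum>\<alpha>\<in>UNIV. \<Sum>\<beta>\<in>UNIV. e $ \<alpha> * e $ \<beta> * B (axis \<alpha> 1) (axis \<beta> 1))"
    by (subst sum.swap, subst (2) sum.swap) (rule refl)
  also have "\<dots> = (\<Sum>e\<in>S. B (\<Sum>\<alpha>\<in>UNIV. e $ \<alpha> *\<^sub>R axis \<alpha> 1) (\<Sum>\<beta>\<in>UNIV. e $ \<beta> *\<^sub>R axis \<beta> 1))"
    by (subst bilinear_lsum[OF B])
      (simp add: bilinear_rsum[OF B] bilinear_rmul[OF B] bilinear_lmul[OF B] sum_distrib_left mult_ac)
  also have "\<dots> = (\<Sum>e\<in>S. B e e)" by (simp add: axis_expand)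
  also have "\<dots> < 0"
  proof -
    \<comment> \<open>Strictness comes from positive dimension: the index type is nonempty, so the
      vector \<open>1\<close> is nonzero and its expansion must contain a nonzero
      \<open>e\<close>.\<close>
    have "\<exists>e\<in>S. e \<noteq> 0"
    proof (rule ccontr)
      assume "\<not> ?thesis"
      then have "(\<Sum>e\<in>S. g 1 e *\<^sub>R e) = 0" by (intro sum.neutral) auto
      then have "(1::real^'k) = 0" by (simp only: S(2)[symmetric])
      then show False by simp
    qed
    moreover have "B e e \<le> 0" for e
      using neg[of e] by (cases "e = 0") (auto simp: bilinear_lzero[OF B])
    ultimately have "(\<Sum>e\<in>S. B e e) < (\<Sum>e\<in>S. 0)"
      using neg S(1) by (intro sum_strict_mono_ex1) auto
    then show ?thesis by simp
  qed
  finally show ?thesis by (simp add: m_def)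
qed

section \<open>The Levi-Civita derivative from the Koszul formula\<close>

lemma linear_dir_deriv:
  assumes "f differentiable (at x)"
  shows "linear (dir_deriv f x)"
  using linear_frechet_derivative[OF assms] by (simp add: dir_deriv_def[abs_def])

lemma has_derivative_dir_deriv:
  assumes "f differentiable (at x)"
  shows "(f has_derivative dir_deriv f x) (at x)"
  using assms by (simp add: frechet_derivative_works dir_deriv_def[abs_def])

lemma dir_deriv_eqI:
  assumes "(f has_derivative f') (at x)"
  shows "dir_deriv f x v = f' v"
  unfolding dir_deriv_def using frechet_derivative_at[OF assms] by simp

lemma bilinear_expansion:
  fixes g :: "'a::euclidean_space \<Rightarrow> 'b::euclidean_space \<Rightarrow> real"
  assumes "bilinear g"
  shows "g v w = (\<Sum>i\<in>Basis. \<Sum>j\<in>Basis. (v \<bullet> i) * (w \<bullet> j) * g i j)"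
proof -
  have "g v w = g (\<Sum>i\<in>Basis. (v \<bullet> i) *\<^sub>R i) w"
    by (simp only: euclidean_representation)
  also have "\<dots> = (\<Sum>i\<in>Basis. (v \<bullet> i) * g i w)"
    unfolding bilinear_lsum[OF assms] bilinear_lmul[OF assms] by simp
  also have "\<dots> = (\<Sum>i\<in>Basis. (v \<bullet> i) * g i (\<Sum>j\<in>Basis. (w \<bullet> j) *\<^sub>R j))"
    by (simp only: euclidean_representation)
  also have "\<dots> = (\<Sum>i\<in>Basis. \<Sum>j\<in>Basis. (v \<bullet> i) * (w \<bullet> j) * g i j)"
    unfolding bilinear_rsum[OF assms] bilinear_rmul[OF assms] by (simp add: sum_distrib_left mult_ac)
  finally show ?thesis .
qed

text \<open>Bilinearity is required at every point, so that linearity in the vector arguments can be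
  differentiated and passes to \<open>D\<close>. Positivity and differentiability concern the single
  point \<open>x\<close>.\<close>

locale metric_at =
  fixes G :: "'a::euclidean_space \<Rightarrow> 'a \<Rightarrow> 'a \<Rightarrow> real" and x :: 'a
  assumes bil: "bilinear (G y)"
    and pos_def: "pos_def_form (G x)"
    and diff: "(\<lambda>y. G y v w) differentiable (at x)"
begin

definition D :: "'a \<Rightarrow> 'a \<Rightarrow> 'a \<Rightarrow> real" where
  "D e v w = dir_deriv (\<lambda>y. G y v w) x e"

lemma D_linear1: "linear (\<lambda>e. D e v w)"
  unfolding D_def by (rule linear_dir_deriv[OF diff])

lemma D_linear2: "linear (\<lambda>v. D e v w)"
proof (rule linearI)
  fix v v' c
  show "D e (v + v') w = D e v w + D e v' w" unfolding D_def
    by (subst bilinear_ladd[OF bil], rule dir_deriv_eqI, rule has_derivative_add)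
      (rule has_derivative_dir_deriv[OF diff])+
  show "D e (c *\<^sub>R v) w = c *\<^sub>R D e v w" unfolding D_def
    by (subst bilinear_lmul[OF bil], rule dir_deriv_eqI, rule has_derivative_scaleR_right)
      (rule has_derivative_dir_deriv[OF diff])
qed

lemma D_linear3: "linear (\<lambda>w. D e v w)"
proof (rule linearI)
  fix w w' c
  show "D e v (w + w') = D e v w + D e v w'" unfolding D_def
    by (subst bilinear_radd[OF bil], rule dir_deriv_eqI, rule has_derivative_add)
      (rule has_derivative_dir_deriv[OF diff])+
  show "D e v (c *\<^sub>R w) = c *\<^sub>R D e v w" unfolding D_def
    by (subst bilinear_rmul[OF bil], rule dir_deriv_eqI, rule has_derivative_scaleR_right)
      (rule has_derivative_dir_deriv[OF diff])
qed

text \<open>The Koszul expression is linear in \<open>e\<close>, so a vector represents it, and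
  nondegeneracy of \<open>G x\<close> makes that vector unique. This resolves the definite
  description in \<open>christoffel\<close>.\<close>

lemma christoffel_koszul:
  "2 * G x (christoffel G x v w) e = D v w e + D w v e - D e v w"
proof -
  have L: "linear (\<lambda>e. (D v w e + D w v e - D e v w) / 2)"
    by (rule linearI) (simp_all add: linear_add[OF D_linear1] linear_add[OF D_linear3]
        linear_cmul[OF D_linear1] linear_cmul[OF D_linear3] field_simps)
  obtain c where "\<forall>e. G x c e = (D v w e + D w v e - D e v w) / 2"
    using pos_def_form_represent[OF pos_def L] by blast
  then have c: "\<forall>e. 2 * G x c e = D v w e + D w v e - D e v w" by (simp add: field_simps)
  have "christoffel G x v w = c"
    unfolding christoffel_def D_def[symmetric]
  proof (rule the_equality[of _ c])
    show "\<forall>e. 2 * G x c e = D v w e + D w v e - D e v w" by (rule c)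
    fix d assume "\<forall>e. 2 * G x d e = D v w e + D w v e - D e v w"
    then show "d = c" using c by (intro pos_def_form_eqI[OF pos_def]) (metis mult_cancel_left zero_neq_numeral)
  qed
  then show ?thesis using c by simp
qed

text \<open>Product rule along a curve. Differentiability of \<open>G\<close> is given for fixed
  vector arguments, so all three factors are first expanded in a basis.\<close>

lemma has_real_derivative_along:
  assumes c: "(c has_vector_derivative c') (at \<tau>)" "c \<tau> = x"
    and p: "(p has_vector_derivative p') (at \<tau>)"
    and q: "(q has_vector_derivative q') (at \<tau>)"
  shows "((\<lambda>\<tau>. G (c \<tau>) (p \<tau>) (q \<tau>)) has_real_derivative
    D c' (p \<tau>) (q \<tau>) + G x p' (q \<tau>) + G x (p \<tau>) q') (at \<tau>)"
proof -
  have expand: "G y v w = (\<Sum>i\<in>Basis. \<Sum>j\<in>Basis. (v \<bullet> i) * (w \<bullet> j) * G y i j)" for y v w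
    by (rule bilinear_expansion[OF bil])
  have expandD: "D e v w = (\<Sum>i\<in>Basis. \<Sum>j\<in>Basis. (v \<bullet> i) * (w \<bullet> j) * D e i j)" for e v w
    by (rule bilinear_expansion) (use D_linear2 D_linear3 in \<open>auto simp: bilinear_def\<close>)
  have comp: "((\<lambda>\<tau>. h \<tau> \<bullet> i) has_real_derivative (h' \<bullet> i)) (at \<tau>)"
    if "(h has_vector_derivative h') (at \<tau>)" for h :: "real \<Rightarrow> 'a" and h' i
    using bounded_linear.has_vector_derivative[OF bounded_linear_inner_left that, of i]
    by (simp add: has_real_derivative_iff_has_vector_derivative)
  have G': "((\<lambda>\<tau>. G (c \<tau>) i j) has_real_derivative D c' i j) (at \<tau>)" for i j
  proof -
    have "((\<lambda>y. G y i j) has_derivative (\<lambda>e. D e i j)) (at (c \<tau>))"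
      unfolding D_def c(2) by (rule has_derivative_dir_deriv[OF diff])
    from has_derivative_compose[OF c(1)[unfolded has_vector_derivative_def] this]
    show ?thesis
      unfolding has_field_derivative_def linear_cmul[OF D_linear1] by (simp add: mult_commute_abs)
  qed
  have "((\<lambda>\<tau>. \<Sum>i\<in>Basis. \<Sum>j\<in>Basis. (p \<tau> \<bullet> i) * (q \<tau> \<bullet> j) * G (c \<tau>) i j) has_real_derivative
     (\<Sum>i\<in>Basis. \<Sum>j\<in>Basis. (p \<tau> \<bullet> i) * (q \<tau> \<bullet> j) * D c' i j
        + (p' \<bullet> i) * (q \<tau> \<bullet> j) * G x i j + (p \<tau> \<bullet> i) * (q' \<bullet> j) * G x i j)) (at \<tau>)"
    by (rule derivative_eq_intros G' comp[OF p] comp[OF q] refl)+ (simp add: c(2) algebra_simps)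
  then show ?thesis
    unfolding expand[symmetric] by (simp only: sum.distrib expand[symmetric] expandD[symmetric])
qed

end

text \<open>If \<open>d > 0\<close>, then \<open>m\<close>, which vanishes at 0, is positive just to
  the right of 0, and so is \<open>h'\<close>; by the mean value theorem \<open>h\<close> then
  exceeds \<open>h 0\<close>. The factor \<open>\<kappa>\<close> enters only through its
  sign.\<close>

lemma second_derivative_nonpos_at_max:
  fixes h h' \<kappa> m :: "real \<Rightarrow> real"
  assumes \<delta>: "\<delta> > 0"
    and h: "\<And>\<tau>. \<bar>\<tau>\<bar> < \<delta> \<Longrightarrow> (h has_real_derivative h' \<tau>) (at \<tau>)"
    and max: "\<And>\<tau>. \<bar>\<tau>\<bar> < \<delta> \<Longrightarrow> h \<tau> \<le> h 0"
    and \<kappa>: "\<And>\<tau>. \<bar>\<tau>\<bar> < \<delta> \<Longrightarrow> \<kappa> \<tau> > 0"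
    and m: "\<And>\<tau>. \<bar>\<tau>\<bar> < \<delta> \<Longrightarrow> m \<tau> = \<kappa> \<tau> * h' \<tau>"
    and d: "(m has_real_derivative d) (at 0)"
  shows "d \<le> 0"
proof (rule ccontr)
  assume "\<not> d \<le> 0"
  then have "d > 0" by simp
  have "h' 0 = 0"
    using DERIV_local_max[OF h[of 0] \<delta>] max \<delta> by auto
  then have m0: "m 0 = 0" using m[of 0] \<delta> by simp
  obtain \<epsilon> where \<epsilon>: "\<epsilon> > 0" "\<And>k. k > 0 \<Longrightarrow> k < \<epsilon> \<Longrightarrow> m 0 < m (0 + k)"
    using DERIV_pos_inc_right[OF d \<open>d > 0\<close>] by blast
  define b where "b = min \<delta> \<epsilon> / 2"
  have b: "b > 0" "b < \<delta>" "b < \<epsilon>" using \<delta> \<epsilon>(1) by (auto simp: b_def min_def)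
  obtain z where z: "0 < z" "z < b" "h b - h 0 = (b - 0) * h' z"
    using MVT2[OF b(1), of h h'] h b by auto
  have "m z > 0" using \<epsilon>(2)[of z] z b m0 by simp
  then have "h' z > 0" using m[of z] \<kappa>[of z] z b by (simp add: zero_less_mult_iff)
  then have "(b - 0) * h' z > 0" using b by simp
  then have "h b > h 0" using z(3) by linarith
  then show False using max[of b] b by simp
qed

section \<open>First and second derivatives of parametrizations\<close>

lemma local_parametrizationD:
  assumes "local_parametrization M V W f"
  shows "open V" "open W" "f ` W = M \<inter> V" "z \<in> W \<Longrightarrow> f differentiable (at z)"
    "z \<in> W \<Longrightarrow> (\<lambda>z. dir_deriv f z v) differentiable (at z)"
    "z \<in> W \<Longrightarrow> inj (dir_deriv f z)"
proof -
  show "open V" "open W" using assms by (auto simp: local_parametrization_def)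
  show "f ` W = M \<inter> V" using assms by (auto simp: local_parametrization_def homeomorphism_def)
  have "Ck_on (Suc (Suc 0)) W f"
    using assms unfolding local_parametrization_def smooth_on_def by blast
  then show "z \<in> W \<Longrightarrow> f differentiable (at z)"
    "z \<in> W \<Longrightarrow> (\<lambda>z. dir_deriv f z v) differentiable (at z)"
    by (auto simp: dir_deriv_def)
  show "z \<in> W \<Longrightarrow> inj (dir_deriv f z)"
    using assms by (simp add: local_parametrization_def dir_deriv_def[abs_def])
qed

text \<open>Linearity in \<open>v\<close> is inherited from the first derivative. That identity
  holds at every \<open>z\<close> of the open set \<open>W\<close>, hence may be differentiated at
  \<open>\<xi>\<close>.\<close>

lemma bilinear_second_dir_deriv:
  assumes "open W" "\<xi> \<in> W" and f: "\<And>z. z \<in> W \<Longrightarrow> f differentiable (at z)"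
    and f2: "\<And>v. (\<lambda>z. dir_deriv f z v) differentiable (at \<xi>)"
  shows "bilinear (\<lambda>u v. dir_deriv (\<lambda>z. dir_deriv f z v) \<xi> u)"
  unfolding bilinear_def
proof (intro conjI allI)
  show "linear (\<lambda>u. dir_deriv (\<lambda>z. dir_deriv f z v) \<xi> u)" for v
    by (rule linear_dir_deriv[OF f2])
  show "linear (\<lambda>v. dir_deriv (\<lambda>z. dir_deriv f z v) \<xi> u)" for u
  proof (rule linearI)
    fix v v' c
    have "((\<lambda>z. dir_deriv f z (v + v')) has_derivative (\<lambda>u. dir_deriv (\<lambda>z. dir_deriv f z v) \<xi> u
        + dir_deriv (\<lambda>z. dir_deriv f z v') \<xi> u)) (at \<xi>)"
      by (rule has_derivative_transform_within_open[OF has_derivative_add[OF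
            has_derivative_dir_deriv[OF f2[of v]] has_derivative_dir_deriv[OF f2[of v']]] assms(1,2)])
        (simp add: linear_add[OF linear_dir_deriv[OF f]])
    then show "dir_deriv (\<lambda>z. dir_deriv f z (v + v')) \<xi> u =
        dir_deriv (\<lambda>z. dir_deriv f z v) \<xi> u + dir_deriv (\<lambda>z. dir_deriv f z v') \<xi> u"
      by (rule dir_deriv_eqI)
    have "((\<lambda>z. dir_deriv f z (c *\<^sub>R v)) has_derivative
        (\<lambda>u. c *\<^sub>R dir_deriv (\<lambda>z. dir_deriv f z v) \<xi> u)) (at \<xi>)"
      by (rule has_derivative_transform_within_open[OF has_derivative_scaleR_right[OF
            has_derivative_dir_deriv[OF f2[of v]]] assms(1,2)])
        (simp add: linear_cmul[OF linear_dir_deriv[OF f]])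
    then show "dir_deriv (\<lambda>z. dir_deriv f z (c *\<^sub>R v)) \<xi> u =
        c *\<^sub>R dir_deriv (\<lambda>z. dir_deriv f z v) \<xi> u"
      by (rule dir_deriv_eqI)
  qed
qed

section \<open>A maximum principle for minimal submanifolds\<close>

text \<open>
  \<open>\<kappa>\<close> rescales \<open>N\<close> to the gradient of \<open>\<phi>\<close>, so that \<open>D (N x) v v + 2 * G x v (N v)\<close>, the Lie
  derivative of the metric along \<open>N\<close>, is a positive multiple of the Hessian of \<open>\<phi>\<close> on vectors
  tangent to the level set through \<open>x\<close>.
\<close>

lemma (in metric_at) minimal_submanifold_no_max:
  fixes M :: "'a set"
  assumes N: "linear N"
    and U: "open U" "x \<in> U"
    and \<phi>: "\<And>y. y \<in> U \<Longrightarrow> (\<phi> has_derivative d\<phi> y) (at y)"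
    and \<kappa>: "\<And>y. y \<in> U \<Longrightarrow> \<kappa> y > 0"
    and grad: "\<And>y w. y \<in> U \<Longrightarrow> G y w (N y) = \<kappa> y * d\<phi> y w"
    and conv: "\<And>v. v \<noteq> 0 \<Longrightarrow> D (N x) v v + 2 * G x v (N v) > 0"
    and M: "x \<in> M" "submanifold_euclidean TYPE('k::finite) M" "minimal_euclidean G TYPE('k) M"
    and max: "\<And>y. y \<in> M \<inter> U \<Longrightarrow> \<phi> y \<le> \<phi> x"
  shows False
proof -
  obtain V W and f :: "real ^ 'k \<Rightarrow> 'a" where "x \<in> V" and lp: "local_parametrization M V W f"
    using M(1,2) unfolding submanifold_euclidean_def by blast
  note lpD = local_parametrizationD[OF lp]
  obtain \<xi> where \<xi>: "\<xi> \<in> W" "f \<xi> = x"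
    using lpD(3) M(1) \<open>x \<in> V\<close> by (metis IntI imageE)
  define F where "F = dir_deriv f \<xi>"
  define F2 where "F2 u v = dir_deriv (\<lambda>z. dir_deriv f z v) \<xi> u" for u v
  have F: "linear F" "inj F"
    unfolding F_def using linear_dir_deriv[OF lpD(4)[OF \<xi>(1)]] lpD(6)[OF \<xi>(1)] .
  have F2: "bilinear F2"
    unfolding F2_def[abs_def] by (rule bilinear_second_dir_deriv[OF lpD(2) \<xi>(1) lpD(4) lpD(5)[OF \<xi>(1)]])
  \<comment> \<open>The second fundamental form paired with \<open>N x\<close> (shown in
    \<open>II\<close> below), written out by the Koszul formula so that its bilinearity is
    visible.\<close>
  define B where "B u v = G x (F2 u v) (N x) +
    (D (F u) (F v) (N x) + D (F v) (F u) (N x) - D (N x) (F u) (F v)) / 2" for u v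
  have B: "bilinear B"
    unfolding bilinear_def B_def
    by (intro conjI allI linearI)
      (simp_all add: bilinear_ladd[OF F2] bilinear_radd[OF F2] bilinear_lmul[OF F2] bilinear_rmul[OF F2]
        bilinear_ladd[OF bil] bilinear_lmul[OF bil] linear_add[OF F(1)] linear_cmul[OF F(1)]
        linear_add[OF D_linear1] linear_add[OF D_linear2] linear_add[OF D_linear3]
        linear_cmul[OF D_linear1] linear_cmul[OF D_linear2] linear_cmul[OF D_linear3] field_simps)
  define X where "X u v = F2 u v + christoffel G x (F u) (F v)" for u v
  have BX: "B u v = G x (X u v) (N x)" for u v
    using christoffel_koszul[of "F u" "F v" "N x"]
    by (simp add: B_def X_def bilinear_ladd[OF bil])
  \<comment> \<open>The image \<open>c\<close> of a line through \<open>\<xi>\<close> stays in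
    \<open>M\<close>, so \<open>\<phi>\<close> along \<open>c\<close> is maximal at 0. The first
    derivative gives orthogonality to \<open>N x\<close>, the second the inequality.\<close>
  have curve: "G x (F u) (N x) = 0 \<and>
      D (F u) (F u) (N x) + G x (F2 u u) (N x) + G x (F u) (N (F u)) \<le> 0" for u
  proof -
    have "continuous_on W f"
      by (intro differentiable_imp_continuous_on differentiable_at_imp_differentiable_on lpD(4))
    then have "open (W \<inter> f -` U)"
      using lpD(2) U(1) by (rule continuous_open_preimage)
    then have "open ((\<lambda>\<tau>. \<xi> + \<tau> *\<^sub>R u) -` (W \<inter> f -` U))"
      by (rule open_vimage) (intro continuous_intros)
    moreover have "0 \<in> (\<lambda>\<tau>. \<xi> + \<tau> *\<^sub>R u) -` (W \<inter> f -` U)" using \<xi> U(2) by simp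
    ultimately obtain \<delta> where \<delta>: "\<delta> > 0" "ball 0 \<delta> \<subseteq> (\<lambda>\<tau>. \<xi> + \<tau> *\<^sub>R u) -` (W \<inter> f -` U)"
      unfolding open_contains_ball by blast
    then have inW: "\<xi> + \<tau> *\<^sub>R u \<in> W" and inU: "f (\<xi> + \<tau> *\<^sub>R u) \<in> U" if "\<bar>\<tau>\<bar> < \<delta>" for \<tau>
      using that by (auto simp: subset_iff)
    define c where "c \<tau> = f (\<xi> + \<tau> *\<^sub>R u)" for \<tau>
    define p where "p \<tau> = dir_deriv f (\<xi> + \<tau> *\<^sub>R u) u" for \<tau>
    have line: "((\<lambda>\<tau>. \<xi> + \<tau> *\<^sub>R u) has_derivative (\<lambda>t. t *\<^sub>R u)) (at \<tau>)" for \<tau>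
      by (auto intro!: derivative_eq_intros)
    have c': "(c has_vector_derivative p \<tau>) (at \<tau>)" if "\<bar>\<tau>\<bar> < \<delta>" for \<tau>
      using has_derivative_compose[OF line has_derivative_dir_deriv[OF lpD(4)[OF inW[OF that]]]]
      unfolding c_def[abs_def] p_def has_vector_derivative_def
        linear_cmul[OF linear_dir_deriv[OF lpD(4)[OF inW[OF that]]]] .
    have "((\<lambda>z. dir_deriv f z u) has_derivative (\<lambda>v. F2 v u)) (at (\<xi> + 0 *\<^sub>R u))"
      using has_derivative_dir_deriv[OF lpD(5)[OF \<xi>(1)], of u] by (simp add: F2_def)
    from has_derivative_compose[OF line this]
    have p': "(p has_vector_derivative F2 u u) (at 0)"
      unfolding p_def[abs_def] has_vector_derivative_def bilinear_lmul[OF F2] .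
    have c0: "c 0 = x" "p 0 = F u" by (simp_all add: c_def p_def \<xi> F_def)
    have Nc: "((\<lambda>\<tau>. N (c \<tau>)) has_vector_derivative N (F u)) (at 0)"
      using bounded_linear.has_vector_derivative[OF linear_linear[THEN iffD2, OF N] c'[of 0]] \<delta>(1) c0
      by simp
    define h' where "h' \<tau> = d\<phi> (c \<tau>) (p \<tau>)" for \<tau>
    have h: "((\<lambda>\<tau>. \<phi> (c \<tau>)) has_real_derivative h' \<tau>) (at \<tau>)" if "\<bar>\<tau>\<bar> < \<delta>" for \<tau>
    proof -
      have \<phi>': "(\<phi> has_derivative d\<phi> (c \<tau>)) (at (c \<tau>))"
        using \<phi> inU[OF that] by (simp add: c_def)
      show ?thesis
        using has_derivative_compose[OF c'[OF that, unfolded has_vector_derivative_def] \<phi>']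
        unfolding linear_cmul[OF has_derivative_linear[OF \<phi>']] has_field_derivative_def
        by (simp add: h'_def mult_commute_abs)
    qed
    have le: "\<phi> (c \<tau>) \<le> \<phi> (c 0)" if "\<bar>\<tau>\<bar> < \<delta>" for \<tau>
    proof -
      have "c \<tau> \<in> M \<inter> U" using inW[OF that] inU[OF that] lpD(3) by (auto simp: c_def)
      then show ?thesis using max c0 by simp
    qed
    have "h' 0 = 0"
      using DERIV_local_max[OF h[of 0] \<delta>(1)] le \<delta>(1) by auto
    then have 1: "G x (F u) (N x) = 0"
      using grad[OF U(2)] by (simp add: h'_def c0)
    have m: "((\<lambda>\<tau>. G (c \<tau>) (p \<tau>) (N (c \<tau>))) has_real_derivative
        D (F u) (F u) (N x) + G x (F2 u u) (N x) + G x (F u) (N (F u))) (at 0)"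
      using has_real_derivative_along[of c "F u" 0, OF _ c0(1) p' Nc] c'[of 0] \<delta>(1)
      by (simp add: c0)
    \<comment> \<open>Along \<open>c\<close> the assumption \<open>grad\<close> says that the
      pairing of the velocity with \<open>N\<close> is \<open>\<kappa>\<close> times
      \<open>h'\<close>, so \<open>m\<close> has the derivative sign demanded at a maximum.\<close>
    have "D (F u) (F u) (N x) + G x (F2 u u) (N x) + G x (F u) (N (F u)) \<le> 0"
      by (rule second_derivative_nonpos_at_max[OF \<delta>(1) h le _ _ m, of "\<lambda>\<tau>. \<kappa> (c \<tau>)"])
        (auto simp: h'_def c_def intro!: \<kappa> grad inU)
    with 1 show ?thesis by blast
  qed
  \<comment> \<open>On the diagonal the Koszul terms combine, and \<open>curve\<close> bounds
    \<open>B u u\<close> by minus half of the expression in \<open>conv\<close> with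
    \<open>v = F u\<close>.\<close>
  have neg: "B u u < 0" if "u \<noteq> 0" for u
  proof -
    have "F u \<noteq> 0" using F that by (metis linear_injective_0)
    from conv[OF this] curve[of u] show ?thesis by (simp add: B_def field_simps)
  qed
  define g where "g u v = G x (F u) (F v)" for u v
  have g: "pos_def_form g"
    unfolding pos_def_form_def
  proof (intro conjI allI impI)
    show "bilinear g" unfolding bilinear_def g_def
      by (intro conjI allI linearI)
        (simp_all add: bilinear_ladd[OF bil] bilinear_radd[OF bil] bilinear_lmul[OF bil]
          bilinear_rmul[OF bil] linear_add[OF F(1)] linear_cmul[OF F(1)])
    show "g v w = g w v" for v w unfolding g_def by (rule pos_def_formD(2)[OF pos_def])
    show "g v v > 0" if "v \<noteq> 0" for v
      unfolding g_def using F that by (intro pos_def_formD(3)[OF pos_def]) (metis linear_injective_0)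
  qed
  define A where "A = matrix_inv (\<chi> \<alpha> \<beta>. g (axis \<alpha> 1) (axis \<beta> 1))"
  have A: "(\<Sum>\<alpha>\<in>UNIV. \<Sum>\<beta>\<in>UNIV. A $ \<alpha> $ \<beta> * B (axis \<alpha> 1) (axis \<beta> 1)) < 0"
    unfolding A_def by (rule trace_inverse_form[OF g B neg])
  have ind: "matrix_inv (induced_metric G f \<xi>) = A"
    by (simp add: A_def induced_metric_def g_def F_def partial_deriv_def \<xi>)
  \<comment> \<open>Passing to the normal part removes some tangent vector \<open>F u\<close>, which
    \<open>curve\<close> shows to be orthogonal to \<open>N x\<close>.\<close>
  have II: "G x (second_fundamental_form G f \<xi> \<alpha> \<beta>) (N x) = B (axis \<alpha> 1) (axis \<beta> 1)" for \<alpha> \<beta>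
  proof -
    have eq: "second_fundamental_form G f \<xi> \<alpha> \<beta> = normal_part (G x) (range F) (X (axis \<alpha> 1) (axis \<beta> 1))"
      by (simp add: second_fundamental_form_def X_def \<xi> F_def F2_def partial_deriv_def[abs_def]
          dir_deriv_def[abs_def])
    have "subspace (range F)" by (rule linear_subspace_image[OF F(1) subspace_UNIV])
    from normal_part[OF pos_def this, of "X (axis \<alpha> 1) (axis \<beta> 1)"]
    obtain u where "X (axis \<alpha> 1) (axis \<beta> 1) - second_fundamental_form G f \<xi> \<alpha> \<beta> = F u"
      unfolding eq by blast
    then have "G x (X (axis \<alpha> 1) (axis \<beta> 1) - second_fundamental_form G f \<xi> \<alpha> \<beta>) (N x) = 0"
      using curve[of u] by simp
    then show ?thesis by (simp add: BX bilinear_lsub[OF bil])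
  qed
  \<comment> \<open>Paired with \<open>N x\<close>, the mean curvature becomes the trace of
    \<open>B\<close>, which is zero by minimality and negative by \<open>A\<close>.\<close>
  have "mean_curvature G f \<xi> = 0"
    using M(3) lp \<xi>(1) unfolding minimal_euclidean_def by blast
  then have "G x (mean_curvature G f \<xi>) (N x) = 0" by (simp add: bilinear_lzero[OF bil])
  then have "(\<Sum>\<alpha>\<in>UNIV. \<Sum>\<beta>\<in>UNIV. A $ \<alpha> $ \<beta> * B (axis \<alpha> 1) (axis \<beta> 1)) = 0"
    by (simp add: mean_curvature_def ind bilinear_lsum[OF bil] bilinear_lmul[OF bil] II)
  with A show False by simp
qed

section \<open>The Calabi-Eguchi-Hanson metric in a chart\<close>

lemma Re_mult_cnj: "Re (z * cnj w) = z \<bullet> w"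
  by (simp add: inner_complex_def)

lemma Re_herm: "Re (herm x y) = x \<bullet> y"
  unfolding herm_def inner_vec_def Re_sum Re_mult_cnj ..

lemma linear_herm_left: "linear (\<lambda>x. herm x y)"
proof (rule linearI)
  show "herm (x + x') y = herm x y + herm x' y" for x x' by (rule herm_add_left)
  show "herm (c *\<^sub>R x) y = c *\<^sub>R herm x y" for c x by (simp add: herm_def scaleR_sum_right)
qed

lemma linear_herm_right: "linear (herm x)"
proof (rule linearI)
  show "herm x (y + y') = herm x y + herm x y'" for y y' by (rule herm_add_right)
  show "herm x (c *\<^sub>R y) = c *\<^sub>R herm x y" for c y by (simp add: herm_def scaleR_sum_right)
qed

lemma herm_zero_left [simp]: "herm 0 y = 0"
  by (simp add: herm_def)

lemma linear_fibre_part: "linear (fibre_part i)"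
  using affine_part_deriv by (rule has_derivative_linear)

text \<open>The \<open>r\<close> of \<open>ceh_closed\<close>, as an inner product rather than a
  squared norm, so that the product rule applies directly.\<close>

definition radius2 :: "'n::finite \<Rightarrow> complex ^ 'n \<Rightarrow> real" where
  "radius2 i y = affine_part i y \<bullet> affine_part i y"

lemma radius2_pos: "radius2 i y > 0"
  by (simp add: radius2_def)

definition ceh_H :: "real \<Rightarrow> 'n::finite \<Rightarrow> complex ^ 'n \<Rightarrow> real" where
  "ceh_H a i y = a ^ CARD('n) + (y $ i \<bullet> y $ i) * radius2 i y ^ CARD('n)"

lemma ceh_H_pos: "a > 0 \<Longrightarrow> ceh_H a i y > 0"
  using radius2_pos[of i y] by (simp add: ceh_H_def add_pos_nonneg)

text \<open>Up to the factor r/n this is dt + n t d'(log r), with d' the (1,0) part of the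
  differential: the vertical projection of the Chern connection for the fibre metric r^n |t|^2. Its
  kernel is the horizontal space.\<close>

definition ceh_theta :: "'n::finite \<Rightarrow> complex ^ 'n \<Rightarrow> complex ^ 'n \<Rightarrow> complex" where
  "ceh_theta i y v = y $ i * herm (fibre_part i v) (affine_part i y)
     + of_real (radius2 i y / CARD('n)) * v $ i"

text \<open>The Fubini-Study metric in the affine coordinates of the base.\<close>

definition fs_form :: "'n::finite \<Rightarrow> complex ^ 'n \<Rightarrow> complex ^ 'n \<Rightarrow> complex ^ 'n \<Rightarrow> real" where
  "fs_form i y v v' = (fibre_part i v \<bullet> fibre_part i v') / radius2 i y
     - (herm (fibre_part i v) (affine_part i y) \<bullet> herm (fibre_part i v') (affine_part i y)) / (radius2 i y)\<^sup>2"

text \<open>Real parts of Hermitian products are real inner products. The metric thus splits into a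
  horizontal Fubini-Study part and a vertical part in \<open>ceh_theta\<close>.\<close>

lemma ceh_closed_real:
  fixes y :: "complex ^ 'n::finite"
  shows "ceh_closed a i y v v' = root CARD('n) (ceh_H a i y) *
    (fs_form i y v v' + radius2 i y ^ CARD('n) / ((radius2 i y)\<^sup>2 * ceh_H a i y)
       * (ceh_theta i y v \<bullet> ceh_theta i y v'))"
proof -
  have re: "Re (E / of_real r - p * cnj p' / of_real s + of_real k * (q * cnj q')) =
      Re E / r - (p \<bullet> p') / s + k * (q \<bullet> q')" for E p p' q q' r s k
    by (simp add: inner_complex_def)
  show ?thesis
    unfolding ceh_closed_def Let_def re Re_herm
    by (simp add: fs_form_def ceh_theta_def ceh_H_def radius2_def power2_norm_eq_inner)
qed

lemma linear_ceh_theta: "linear (ceh_theta i y)"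
  by (rule linearI)
    (simp_all add: ceh_theta_def linear_add[OF linear_fibre_part] linear_cmul[OF linear_fibre_part]
      linear_add[OF linear_herm_left] linear_cmul[OF linear_herm_left] distrib_left scaleR_right_distrib add_divide_distrib)

lemma bilinear_ceh_closed: "bilinear (ceh_closed a i y)"
  unfolding bilinear_def
  by (intro conjI allI linearI)
    (simp_all add: ceh_closed_real fs_form_def linear_add[OF linear_fibre_part]
      linear_cmul[OF linear_fibre_part] linear_add[OF linear_herm_left] linear_cmul[OF linear_herm_left]
      linear_add[OF linear_ceh_theta] linear_cmul[OF linear_ceh_theta]
      inner_add_left inner_add_right add_divide_distrib diff_divide_distrib algebra_simps)

lemma ceh_closed_sym: "ceh_closed a i y v w = ceh_closed a i y w v"
  by (simp add: ceh_closed_real fs_form_def inner_commute)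

text \<open>Pythagoras for the Hermitian splitting of \<open>\<eta>\<close> along
  \<open>\<zeta>\<close>: the defect in the Cauchy-Schwarz inequality is the squared norm of the
  orthogonal component.\<close>

lemma fs_form_projection:
  fixes i :: "'n::finite" and y v :: "complex ^ 'n"
  defines "\<zeta> \<equiv> affine_part i y" and "\<eta> \<equiv> fibre_part i v"
  shows "fs_form i y v v = (norm (\<eta> - (herm \<eta> \<zeta> / of_real (radius2 i y)) *s \<zeta>))\<^sup>2 / radius2 i y"
proof -
  define r where "r = radius2 i y"
  define P where "P = herm \<eta> \<zeta>"
  have r: "r > 0" unfolding r_def by (rule radius2_pos)
  have zz: "herm \<zeta> \<zeta> = of_real r" by (simp add: herm_self r_def radius2_def \<zeta>_def power2_norm_eq_inner)
  have cP: "herm \<zeta> \<eta> = cnj P" by (simp add: P_def herm_cnj)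
  define w where "w = \<eta> - (P / of_real r) *s \<zeta>"
  have "\<eta> = w + (P / of_real r) *s \<zeta>" by (simp add: w_def)
  then have "herm \<eta> \<zeta> = herm w \<zeta> + P / of_real r * of_real r"
    by (metis herm_add_left herm_scale_left zz)
  then have wz: "herm w \<zeta> = 0" using r by (simp add: P_def)
  then have zw: "herm \<zeta> w = 0" using herm_cnj[of w \<zeta>] by simp
  have "herm \<eta> \<eta> = herm w w + P * cnj P / of_real r"
  proof -
    have "herm \<eta> \<eta> = herm (w + (P / of_real r) *s \<zeta>) (w + (P / of_real r) *s \<zeta>)"
      by (simp add: w_def)
    also have "\<dots> = herm w w + P * cnj P / of_real r"
      unfolding herm_add_left herm_add_right herm_scale_left herm_scale_right wz zw zz using r by simp
    finally show ?thesis .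
  qed
  then have "Re (herm \<eta> \<eta>) = Re (herm w w) + Re (P * cnj P / of_real r)" by simp
  then have "\<eta> \<bullet> \<eta> = (norm w)\<^sup>2 + (P \<bullet> P) / r"
    unfolding Re_herm Re_divide_of_real Re_mult_cnj by (simp add: power2_norm_eq_inner)
  then have "(\<eta> \<bullet> \<eta>) / r - (P \<bullet> P) / r\<^sup>2 = (norm w)\<^sup>2 / r"
    using r by (simp add: field_simps power2_eq_square)
  then show ?thesis
    by (simp add: fs_form_def w_def P_def r_def \<eta>_def \<zeta>_def)
qed

lemma fs_form_nonneg: "fs_form i y v v \<ge> 0"
  unfolding fs_form_projection using radius2_pos[of i y] by simp

text \<open>Otherwise \<open>\<eta>\<close> would be a multiple of \<open>\<zeta>\<close>; but entry
  \<open>i\<close> is 0 in \<open>\<eta>\<close> and 1 in \<open>\<zeta>\<close>.\<close>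

lemma fs_form_pos:
  assumes "fibre_part i v \<noteq> 0"
  shows "fs_form i y v v > 0"
proof -
  define \<zeta> where "\<zeta> = affine_part i y"
  define \<eta> where "\<eta> = fibre_part i v"
  define c where "c = herm \<eta> \<zeta> / of_real (radius2 i y)"
  have "\<eta> - c *s \<zeta> \<noteq> 0"
  proof
    assume *: "\<eta> - c *s \<zeta> = 0"
    then have "(\<eta> - c *s \<zeta>) $ i = 0" by simp
    then have "c = 0" by (simp add: \<eta>_def \<zeta>_def fibre_part_def affine_part_def)
    with * show False using assms by (simp add: \<eta>_def)
  qed
  then show ?thesis
    unfolding fs_form_projection \<eta>_def[symmetric] \<zeta>_def[symmetric] c_def[symmetric]
    using radius2_pos[of i y] by simp
qed

text \<open>\<open>fibre_part i v\<close> holds the base components. If they vanish, only the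
  t-component is left, and \<open>ceh_theta\<close> is a positive multiple of it.\<close>

lemma fs_form_or_theta_pos:
  fixes y :: "complex ^ 'n::finite"
  assumes "v \<noteq> 0"
  shows "fs_form i y v v > 0 \<or> ceh_theta i y v \<noteq> 0"
proof (cases "fibre_part i v = 0")
  case True
  then have "v $ j = 0" if "j \<noteq> i" for j
  proof -
    have "fibre_part i v $ j = 0" by (simp add: True)
    then show ?thesis using that by (simp add: fibre_part_def)
  qed
  then have "v $ i \<noteq> 0" using assms by (metis vec_eq_iff zero_index)
  then show ?thesis using True radius2_pos[of i y] by (simp add: ceh_theta_def)
qed (use fs_form_pos in blast)

section \<open>Positivity and differentiability of the metric\<close>

lemma pos_def_form_ceh_closed:
  fixes y :: "complex ^ 'n::finite"
  assumes "a > 0"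
  shows "pos_def_form (ceh_closed a i y)"
  unfolding pos_def_form_def
proof (intro conjI allI impI bilinear_ceh_closed)
  show "ceh_closed a i y v w = ceh_closed a i y w v" for v w by (rule ceh_closed_sym)
  fix v :: "complex ^ 'n" assume "v \<noteq> 0"
  define k where "k = radius2 i y ^ CARD('n) / ((radius2 i y)\<^sup>2 * ceh_H a i y)"
  have "k > 0" using radius2_pos[of i y] ceh_H_pos[OF assms, of i y] by (simp add: k_def)
  then have "fs_form i y v v + k * (ceh_theta i y v \<bullet> ceh_theta i y v) > 0"
    using fs_form_or_theta_pos[OF \<open>v \<noteq> 0\<close>, of i y] fs_form_nonneg[of i y v]
    by (auto intro: add_pos_nonneg add_nonneg_pos)
  then show "ceh_closed a i y v v > 0"
    using ceh_H_pos[OF assms, of i y] by (simp add: ceh_closed_real k_def)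
qed

lemma differentiable_inner:
  assumes "f differentiable (at x within S)" "g differentiable (at x within S)"
  shows "(\<lambda>x. f x \<bullet> g x) differentiable (at x within S)"
  using assms has_derivative_inner unfolding differentiable_def by blast

text \<open>\<open>radius2\<close> and \<open>ceh_H\<close> are positive everywhere, also on the
  zero section, so neither the divisions nor the root meet a singularity.\<close>

lemma differentiable_ceh_closed:
  fixes y :: "complex ^ 'n::finite"
  assumes "a > 0"
  shows "(\<lambda>y. ceh_closed a i y v w) differentiable (at y)"
proof -
  have aff: "affine_part i differentiable (at y)"
    using affine_part_deriv by (auto simp: differentiable_def)
  have R: "radius2 i differentiable (at y)"
    unfolding radius2_def[abs_def] by (rule differentiable_inner[OF aff aff])
  have t: "(\<lambda>y. y $ i) differentiable (at y)"
    using bounded_linear_imp_has_derivative[OF bounded_linear_vec_nth] by (auto simp: differentiable_def)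
  have H: "ceh_H a i differentiable (at y)"
    unfolding ceh_H_def[abs_def]
    by (intro differentiable_add differentiable_const differentiable_mult differentiable_inner
        differentiable_power t R)
  have "(root CARD('n) has_field_derivative
      inverse (real CARD('n) * root CARD('n) (ceh_H a i y) ^ (CARD('n) - Suc 0))) (at (ceh_H a i y))"
    by (rule DERIV_real_root) (simp_all add: ceh_H_pos[OF assms])
  then have "root CARD('n) differentiable (at (ceh_H a i y))"
    by (auto simp: differentiable_def has_field_derivative_def)
  then have root: "(\<lambda>y. root CARD('n) (ceh_H a i y)) differentiable (at y)"
    using differentiable_chain_at[OF H] by (simp add: o_def)
  have herm: "(\<lambda>y. herm u (affine_part i y)) differentiable (at y)" for u :: "complex ^ 'n"
  proof -
    have "herm u differentiable (at (affine_part i y))"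
      using bounded_linear_imp_has_derivative[OF linear_linear[THEN iffD2, OF linear_herm_right]]
      by (auto simp: differentiable_def)
    then show ?thesis using differentiable_chain_at[OF aff] by (simp add: o_def)
  qed
  have ofR: "(\<lambda>y. complex_of_real (radius2 i y / real CARD('n))) differentiable (at y)"
  proof -
    have "(\<lambda>y. radius2 i y / real CARD('n)) differentiable (at y)"
      by (intro differentiable_divide R differentiable_const) simp
    moreover have "complex_of_real differentiable (at (radius2 i y / real CARD('n)))"
      unfolding differentiable_def
      by (intro exI) (rule bounded_linear_imp_has_derivative[OF bounded_linear_of_real])
    ultimately show ?thesis using differentiable_chain_at by (fastforce simp: o_def)
  qed
  have \<theta>: "(\<lambda>y. ceh_theta i y u) differentiable (at y)" for u
    unfolding ceh_theta_def
    by (intro differentiable_add differentiable_mult differentiable_const t herm ofR)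
  have fs: "(\<lambda>y. fs_form i y v w) differentiable (at y)"
    unfolding fs_form_def
    using radius2_pos[of i y]
    by (intro differentiable_diff differentiable_divide differentiable_inner differentiable_const
        differentiable_power R herm) auto
  show ?thesis
    unfolding ceh_closed_real using radius2_pos[of i y] ceh_H_pos[OF assms, of i y]
    by (intro differentiable_mult differentiable_add differentiable_divide root fs differentiable_power R
        differentiable_inner \<theta> H) simp
qed

section \<open>Convexity of the level sets\<close>

text \<open>The Euler field of the fibre, generating real scalings of t. As t scales like the n-th
  power of w, it is 1/n times the Euler field of w-space. In the chart it is a linear map, as the
  maximum principle requires.\<close>

definition radial :: "'n::finite \<Rightarrow> complex ^ 'n \<Rightarrow> complex ^ 'n" where
  "radial i y = y $ i *s axis i 1"

lemma linear_radial: "linear (radial i)"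
  by (rule linearI) (simp_all add: radial_def vec_eq_iff axis_def)

lemma fibre_part_radial [simp]: "fibre_part i (radial i y) = 0"
  by (simp add: fibre_part_def radial_def vec_eq_iff axis_def)

lemma radial_nth [simp]: "radial i y $ i = y $ i"
  by (simp add: radial_def)

lemma affine_part_add_radial: "affine_part i (y + c *\<^sub>R radial i y') = affine_part i y"
  by (simp add: affine_part_def radial_def vec_eq_iff axis_def)

lemma metric_at_ceh:
  assumes "a > 0"
  shows "metric_at (ceh_closed a i) y"
  by unfold_locales (rule bilinear_ceh_closed pos_def_form_ceh_closed[OF assms]
      differentiable_ceh_closed[OF assms])+

text \<open>The left side is the derivative at \<open>\<tau> = 0\<close> of the metric pulled back
  under scaling t by \<open>1 + \<tau>\<close>. This scaling fixes the Fubini-Study part and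
  multiplies \<open>ceh_theta\<close> by \<open>1 + \<tau>\<close>, which leaves a one-variable
  computation.\<close>

lemma ceh_lie_radial_pos:
  fixes y :: "complex ^ 'n::finite"
  assumes a: "a > 0" and y: "y $ i \<noteq> 0" and v: "v \<noteq> 0"
  shows "metric_at.D (ceh_closed a i) y (radial i y) v v + 2 * ceh_closed a i y v (radial i v) > 0"
proof -
  interpret metric_at "ceh_closed a i" y by (rule metric_at_ceh[OF a])
  define n where "n = CARD('n)"
  have n: "n > 0" by (simp add: n_def)
  define r where "r = radius2 i y"
  \<comment> \<open>The value of u^n at \<open>y\<close>; it is positive because \<open>y\<close>
    lies off the zero section.\<close>
  define s where "s = (y $ i \<bullet> y $ i) * r ^ n"
  define X where "X = fs_form i y v v"
  define K where "K = r ^ n / r\<^sup>2 * (ceh_theta i y v \<bullet> ceh_theta i y v)"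
  define H where "H = ceh_H a i y"
  have r: "r > 0" unfolding r_def by (rule radius2_pos)
  have s: "s > 0" using y r by (simp add: s_def)
  have H: "H > 0" "H = a ^ n + s"
    using ceh_H_pos[OF a] by (simp_all add: H_def ceh_H_def s_def r_def n_def)
  have XK: "X \<ge> 0" "K \<ge> 0" "X > 0 \<or> K > 0"
    using fs_form_or_theta_pos[OF v, of i y] fs_form_nonneg[of i y v] r by (auto simp: X_def K_def)
  have flow: "((\<lambda>\<tau>. y + \<tau> *\<^sub>R radial i y) has_vector_derivative radial i y) (at 0)" for y
    by (auto intro!: derivative_eq_intros)
  have g: "ceh_closed a i (y + \<tau> *\<^sub>R radial i y) (v + \<tau> *\<^sub>R radial i v) (v + \<tau> *\<^sub>R radial i v) =
      root n (a ^ n + (1 + \<tau>)\<^sup>2 * s) * (X + K * (1 + \<tau>)\<^sup>2 / (a ^ n + (1 + \<tau>)\<^sup>2 * s))" for \<tau>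
  proof -
    have nth: "(u + \<tau> *\<^sub>R radial i u) $ i = (1 + \<tau>) *\<^sub>R u $ i" for u
      by (simp add: algebra_simps)
    have fib: "fibre_part i (v + \<tau> *\<^sub>R radial i v) = fibre_part i v"
      by (simp add: linear_add[OF linear_fibre_part] linear_cmul[OF linear_fibre_part])
    have R: "radius2 i (y + \<tau> *\<^sub>R radial i y) = r"
      by (simp add: radius2_def affine_part_add_radial r_def)
    have "ceh_H a i (y + \<tau> *\<^sub>R radial i y) = a ^ n + (1 + \<tau>)\<^sup>2 * s"
      unfolding ceh_H_def R nth by (simp add: s_def n_def power2_eq_square)
    moreover have "ceh_theta i (y + \<tau> *\<^sub>R radial i y) (v + \<tau> *\<^sub>R radial i v) = (1 + \<tau>) *\<^sub>R ceh_theta i y v"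
      unfolding ceh_theta_def R nth fib affine_part_add_radial
      by (simp add: r_def scaleR_conv_of_real add_divide_distrib algebra_simps)
    moreover have "fs_form i (y + \<tau> *\<^sub>R radial i y) (v + \<tau> *\<^sub>R radial i v) (v + \<tau> *\<^sub>R radial i v) = X"
      unfolding fs_form_def R fib affine_part_add_radial by (simp add: X_def fs_form_def r_def)
    ultimately show ?thesis
      unfolding ceh_closed_real R by (simp add: n_def[symmetric] K_def power2_eq_square)
  qed
  define \<rho> where "\<rho> = inverse (real n * root n H ^ (n - Suc 0))"
  have \<rho>: "\<rho> > 0" "(root n has_real_derivative \<rho>) (at H)"
    using n H(1) DERIV_real_root[OF n H(1)] by (simp_all add: \<rho>_def)
  have Hd: "((\<lambda>\<tau>. a ^ n + (1 + \<tau>)\<^sup>2 * s) has_real_derivative 2 * s) (at 0)"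
    by (auto intro!: derivative_eq_intros)
  have rootd: "((\<lambda>\<tau>. root n (a ^ n + (1 + \<tau>)\<^sup>2 * s)) has_real_derivative \<rho> * (2 * s)) (at 0)"
    by (rule DERIV_chain2[OF _ Hd]) (use \<rho>(2) H(2) in simp)
  \<comment> \<open>In the quotient rule the terms with \<open>s\<close> cancel and the numerator
    keeps only \<open>a ^ n\<close>.\<close>
  have Kd: "((\<lambda>\<tau>. X + K * (1 + \<tau>)\<^sup>2 / (a ^ n + (1 + \<tau>)\<^sup>2 * s)) has_real_derivative
      2 * K * a ^ n / H\<^sup>2) (at 0)"
    using H by (auto intro!: derivative_eq_intros simp: field_simps power2_eq_square)
  \<comment> \<open>Both sides differentiate the same function at 0: once by the product rule for
    the metric along the flow, once by the explicit formula \<open>g\<close>.\<close>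
  have "D (radial i y) v v + ceh_closed a i y (radial i v) v + ceh_closed a i y v (radial i v) =
      \<rho> * (2 * s) * (X + K / H) + root n H * (2 * K * a ^ n / H\<^sup>2)"
  proof (rule DERIV_unique)
    show "((\<lambda>\<tau>. ceh_closed a i (y + \<tau> *\<^sub>R radial i y) (v + \<tau> *\<^sub>R radial i v) (v + \<tau> *\<^sub>R radial i v))
        has_real_derivative D (radial i y) v v + ceh_closed a i y (radial i v) v
          + ceh_closed a i y v (radial i v)) (at 0)"
      using has_real_derivative_along[OF flow _ flow flow, of y v v] by simp
    show "((\<lambda>\<tau>. ceh_closed a i (y + \<tau> *\<^sub>R radial i y) (v + \<tau> *\<^sub>R radial i v) (v + \<tau> *\<^sub>R radial i v))
        has_real_derivative \<rho> * (2 * s) * (X + K / H) + root n H * (2 * K * a ^ n / H\<^sup>2)) (at 0)"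
      unfolding g using DERIV_mult[OF rootd Kd] H(2) by (simp add: algebra_simps)
  qed
  \<comment> \<open>This gives strict positivity of the first summand; the second is only
    nonnegative, as \<open>K\<close> may vanish.\<close>
  moreover have "X + K / H > 0"
    using XK H(1) by (metis add_nonneg_pos add_pos_nonneg divide_nonneg_pos divide_pos_pos)
  then have "\<rho> * (2 * s) * (X + K / H) + root n H * (2 * K * a ^ n / H\<^sup>2) > 0"
    using mult_pos_pos[of "\<rho> * (2 * s)" "X + K / H"] \<rho>(1) s XK(2) H(1) n a
    by (intro add_pos_nonneg) simp_all
  ultimately show ?thesis using ceh_closed_sym[of a i y v "radial i v"] by linarith
qed

section \<open>The radius in charts and on the total space\<close>

text \<open>This is \<open>u\<^sup>n\<close> for the function \<open>u = \<bar>z\<bar>\<^sup>2\<close> of the paper, since \<open>w = t\<^bsup>1/n\<^esup> \<zeta>\<close>.\<close>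

definition level :: "'n::finite \<Rightarrow> complex ^ 'n \<Rightarrow> real" where
  "level i y = (y $ i \<bullet> y $ i) * radius2 i y ^ CARD('n)"

definition level_deriv :: "'n::finite \<Rightarrow> complex ^ 'n \<Rightarrow> complex ^ 'n \<Rightarrow> real" where
  "level_deriv i y v = 2 * (y $ i \<bullet> v $ i) * radius2 i y ^ CARD('n)
     + (y $ i \<bullet> y $ i) * (CARD('n) * radius2 i y ^ (CARD('n) - 1) * (2 * (fibre_part i v \<bullet> affine_part i y)))"

lemma has_derivative_level: "(level i has_derivative level_deriv i y) (at y)"
proof -
  have t: "((\<lambda>y. y $ i) has_derivative (\<lambda>v. v $ i)) (at y)"
    by (rule bounded_linear_imp_has_derivative[OF bounded_linear_vec_nth])
  have R: "(radius2 i has_derivative (\<lambda>v. 2 * (fibre_part i v \<bullet> affine_part i y))) (at y)"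
    unfolding radius2_def[abs_def]
    by (rule has_derivative_eq_rhs[OF has_derivative_inner[OF affine_part_deriv affine_part_deriv]])
      (simp add: inner_commute)
  show ?thesis
    unfolding level_def[abs_def]
    by (rule has_derivative_eq_rhs[OF has_derivative_mult[OF has_derivative_inner[OF t t] has_derivative_power[OF R]]])
      (simp add: level_deriv_def fun_eq_iff inner_commute algebra_simps)
qed

text \<open>The radial field is a positive multiple of the gradient of \<open>level\<close>. The
  Fubini-Study part annihilates it, and its \<open>ceh_theta\<close> is (r/n) t, whose inner product
  with \<open>ceh_theta i y v\<close> is proportional to \<open>level_deriv i y v\<close>.\<close>

lemma ceh_closed_radial:
  fixes y :: "complex ^ 'n::finite"
  assumes "a > 0"
  shows "ceh_closed a i y v (radial i y) =
    root CARD('n) (ceh_H a i y) / (2 * (real CARD('n))\<^sup>2 * ceh_H a i y) * level_deriv i y v"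
proof -
  define n where "n = CARD('n)"
  have n: "real n > 0" by (simp add: n_def)
  define r where "r = radius2 i y"
  define H where "H = ceh_H a i y"
  define t where "t = y $ i"
  have r: "r > 0" unfolding r_def by (rule radius2_pos)
  have H: "H > 0" unfolding H_def by (rule ceh_H_pos[OF assms])
  have fs: "fs_form i y v (radial i y) = 0" by (simp add: fs_form_def)
  have "ceh_theta i y (radial i y) = (r / n) *\<^sub>R t"
    by (simp add: ceh_theta_def r_def n_def t_def scaleR_conv_of_real)
  moreover have "ceh_theta i y v \<bullet> t =
      (t \<bullet> t) * (fibre_part i v \<bullet> affine_part i y) + (r / n) * (t \<bullet> v $ i)"
    unfolding Re_herm[symmetric]
    by (simp add: ceh_theta_def r_def n_def t_def inner_complex_def algebra_simps)
  ultimately have "ceh_closed a i y v (radial i y) = root n H * (r ^ n / (r\<^sup>2 * H) *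
      ((r / n) * ((t \<bullet> t) * (fibre_part i v \<bullet> affine_part i y) + (r / n) * (t \<bullet> v $ i))))"
    by (simp add: ceh_closed_real fs r_def H_def n_def)
  also have "\<dots> = root n H / (2 * (real n)\<^sup>2 * H) * (2 * (t \<bullet> v $ i) * r ^ n
     + (t \<bullet> t) * (n * r ^ (n - 1) * (2 * (fibre_part i v \<bullet> affine_part i y))))"
  proof -
    have "r ^ n = r * r ^ (n - 1)" using n by (cases n) auto
    then show ?thesis using r H n by (simp add: field_simps power2_eq_square)
  qed
  finally show ?thesis by (simp add: level_deriv_def n_def r_def H_def t_def)
qed

text \<open>The function u itself: z^j is the n-th power of w^j, so a real root of its modulus
  recovers the modulus of w^j. It involves no chart and is continuous across the zero
  section.\<close>

definition orbit_radius2 :: "complex ^ 'n::finite \<Rightarrow> real" where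
  "orbit_radius2 z = (\<Sum>j\<in>UNIV. (root CARD('n) (norm (z $ j)))\<^sup>2)"

lemma orbit_radius2_nonneg: "orbit_radius2 z \<ge> 0"
  by (simp add: orbit_radius2_def sum_nonneg)

lemma orbit_radius2_eq_0_iff: "orbit_radius2 z = 0 \<longleftrightarrow> z = 0"
  by (simp add: orbit_radius2_def sum_nonneg_eq_0_iff vec_eq_iff)

lemma continuous_orbit_radius2: "continuous_on S orbit_radius2"
  unfolding orbit_radius2_def by (intro continuous_intros)

text \<open>Since powers are monotone on nonnegative reals, a maximum of the global function is a
  maximum of \<open>level\<close> in each chart containing the point.\<close>

lemma level_eq_orbit_radius2:
  fixes y :: "complex ^ 'n::finite"
  shows "level i y = orbit_radius2 (fst (chart_inv i y)) ^ CARD('n)"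
proof -
  define n where "n = CARD('n)"
  have n: "n > 0" by (simp add: n_def)
  have "orbit_radius2 (fst (chart_inv i y)) =
      (\<Sum>j\<in>UNIV. (root n (norm (affine_part i y $ j) ^ n * norm (y $ i)))\<^sup>2)"
    by (simp add: orbit_radius2_def chart_inv_def norm_mult norm_power n_def)
  also have "\<dots> = (\<Sum>j\<in>UNIV. (root n (norm (y $ i)))\<^sup>2 * (norm (affine_part i y $ j))\<^sup>2)"
    using n by (simp add: real_root_mult real_root_power_cancel power_mult_distrib mult.commute)
  also have "\<dots> = (root n (norm (y $ i)))\<^sup>2 * radius2 i y"
    by (simp add: radius2_def inner_vec_def power2_norm_eq_inner sum_distrib_left)
  finally have "orbit_radius2 (fst (chart_inv i y)) ^ n = ((root n (norm (y $ i))) ^ n)\<^sup>2 * radius2 i y ^ n"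
    by (simp add: power_mult_distrib power_mult[symmetric] mult.commute)
  then show ?thesis
    using n by (simp add: level_def n_def[symmetric] power2_norm_eq_inner)
qed

text \<open>If entry \<open>i\<close> of \<open>\<xi>\<close> vanished, the defining equations with
  nonzero z^i would force every entry of \<open>\<xi>\<close> to vanish.\<close>

lemma total_space_in_chart_dom:
  assumes "p \<in> total_space" "fst p $ i \<noteq> 0"
  shows "p \<in> chart_dom i"
proof -
  from assms(1) obtain z and \<xi> :: "complex ^ 'a" where p: "p = (z, hom \<xi>)" "\<xi> \<noteq> 0"
    "\<And>i j. z $ i * (\<xi> $ j) ^ CARD('a) = z $ j * (\<xi> $ i) ^ CARD('a)"
    unfolding total_space_def by blast
  have "\<xi> $ i \<noteq> 0"
  proof
    assume "\<xi> $ i = 0"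
    then have "\<xi> $ j = 0" for j using p(3)[of i j] assms(2) p(1) by (simp add: zero_power)
    then show False using p(2) by (simp add: vec_eq_iff)
  qed
  then show ?thesis using assms(1) p unfolding chart_dom_def by blast
qed

theorem theorem9:
  fixes a :: real and \<Sigma> :: "((complex ^ 'n::finite) \<times> 'n cproj) set"
  assumes "CARD('n) \<ge> 2" and "a > 0"
    and "compact \<Sigma>"
    and "submanifold TYPE('k::finite) \<Sigma>"
    and "minimal a TYPE('k) \<Sigma>"
  shows "\<Sigma> \<subseteq> zero_section"
proof
  have sub: "\<Sigma> \<subseteq> total_space" using assms(4) by (simp add: submanifold_def)
  fix p assume p: "p \<in> \<Sigma>"
  \<comment> \<open>The radius depends only on the first component, so it is maximized over a
    compact subset of complex n-space.\<close>
  have "compact (fst ` \<Sigma>)"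
    by (intro compact_continuous_image continuous_on_fst continuous_on_id assms(3))
  moreover have "fst ` \<Sigma> \<noteq> {}" using p by blast
  ultimately have "\<exists>z\<in>fst ` \<Sigma>. \<forall>w\<in>fst ` \<Sigma>. orbit_radius2 w \<le> orbit_radius2 z"
    by (intro continuous_attains_sup continuous_orbit_radius2)
  then obtain q where q: "q \<in> \<Sigma>" "\<And>q'. q' \<in> \<Sigma> \<Longrightarrow> orbit_radius2 (fst q') \<le> orbit_radius2 (fst q)"
    by blast
  have "fst q = 0"
  proof (rule ccontr)
    assume "fst q \<noteq> 0"
    then obtain i where i: "fst q $ i \<noteq> 0" by (auto simp: vec_eq_iff)
    define x where "x = chart i q"
    define M where "M = chart i ` (\<Sigma> \<inter> chart_dom i)"
    have qi: "q \<in> chart_dom i" using total_space_in_chart_dom q(1) sub i by blast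
    have xi: "x $ i \<noteq> 0" using i by (simp add: x_def chart_def)
    have metric: "ceh_metric a i = ceh_closed a i"
      by (intro ext ceh_metric_closed_form assms(2))
    interpret metric_at "ceh_closed a i" x by (rule metric_at_ceh[OF assms(2)])
    show False
    \<comment> \<open>\<open>U\<close> is the chart off the zero section. The point \<open>x\<close>
      maximizes \<open>level\<close> over the part of \<open>\<Sigma>\<close> seen there, because
      \<open>q\<close> maximizes the radius over all of \<open>\<Sigma>\<close>.\<close>
    proof (rule minimal_submanifold_no_max[where M = M and N = "radial i" and U = "{y. y $ i \<noteq> 0}" and \<phi> = "level i"
          and d\<phi> = "level_deriv i" and 'k = 'k
          and \<kappa> = "\<lambda>y. root CARD('n) (ceh_H a i y) / (2 * (real CARD('n))\<^sup>2 * ceh_H a i y)"])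
      show "open {y::complex^'n. y $ i \<noteq> 0}"
        by (intro open_Collect_neq continuous_intros)
      show "x \<in> {y. y $ i \<noteq> 0}" using xi by simp
      show "root CARD('n) (ceh_H a i y) / (2 * (real CARD('n))\<^sup>2 * ceh_H a i y) > 0" for y
        using ceh_H_pos[OF assms(2), of i y] by simp
      show "x \<in> M" using q(1) qi by (auto simp: M_def x_def)
      show "submanifold_euclidean TYPE('k) M"
        using assms(4) by (simp add: submanifold_def M_def)
      show "minimal_euclidean (ceh_closed a i) TYPE('k) M"
        using assms(5) unfolding minimal_def M_def metric[symmetric] by blast
      show "level i y \<le> level i x" if "y \<in> M \<inter> {y. y $ i \<noteq> 0}" for y
      proof -
        from that obtain q' where q': "q' \<in> \<Sigma>" "q' \<in> chart_dom i" "y = chart i q'"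
          by (auto simp: M_def)
        then show ?thesis
          using q(2)[OF q'(1)] qi
          by (simp add: level_eq_orbit_radius2 x_def chart_inv_chart power_mono orbit_radius2_nonneg)
      qed
    qed (rule linear_radial has_derivative_level ceh_closed_radial[OF assms(2)]
        ceh_lie_radial_pos[OF assms(2) xi] | assumption)+
  qed
  \<comment> \<open>The maximal radius is 0, so the radius vanishes at the arbitrary point
    \<open>p\<close>.\<close>
  then have "orbit_radius2 (fst p) = 0"
    using q(2)[OF p] orbit_radius2_nonneg[of "fst p"] orbit_radius2_eq_0_iff[of "fst q"] by simp
  then have "fst p = 0" by (simp add: orbit_radius2_eq_0_iff)
  moreover obtain \<xi> where "\<xi> \<noteq> 0" "snd p = hom \<xi>" by (rule cproj_cases)
  ultimately show "p \<in> zero_section"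
    unfolding zero_section_def by (metis (mono_tags, lifting) mem_Collect_eq prod.collapse)
qed

end
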